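(* Let $X$ be a compact Hausdorff space with $w(X)>\mathrm{Sln}(X)$. Then $X$ is (homeomorphic to) the inverse limit of a well-ordered inverse spectrum $\{Z_\alpha,\pi_\alpha^\beta:\alpha\le\beta<\mathrm{Sln}(X)^+\}$, indexed by the ordinals less than $\mathrm{Sln}(X)^+$, consisting of compact Hausdorff spaces $Z_\alpha$ of weight $w(Z_\alpha)\le\mathrm{Sln}(X)$ and monotone bonding maps $\pi_\alpha^\beta:Z_\beta\to Z_\alpha$.
   Context: A continuum is a compact connected Hausdorff space; it is non-degenerate if it has more than one point. For a continuum $K$, the Suslinian number is $\mathrm{Sln}(K)=\sup\{|\mathcal C| : \mathcal C \text{ is a disjoint family of non-degenerate subcontinua of } K\}$. For a Tychonov space $X$, $\mathrm{Sln}(X)=\min\{\mathrm{Sln}(K): K \text{ is a continuum containing } X \text{ (as a subspace, up to homeomorphism)}\}$. Convention: the value of $\mathrm{Sln}$ is taken to be an infinite cardinal (i.e. replaced by $\max\{\aleph_0,\mathrm{Sln}\}$; this only affects spaces with at most one point). $w(X)$ is the weight of $X$, the smallest cardinality of a base of the topology. $\kappa^+$ denotes the successor cardinal of $\kappa$, identified with an initial ordinal. All maps are continuous. A map $f:X\to Y$ is monotone if $f^{-1}(y)$ is connected for every $y\in Y$. *)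

theory Defs
  imports "HOL-Analysis.Analysis"
begin

unbundle cardinal_syntax

text \<open>
  Cardinal numbers are represented as in Main, by relations \<open>r\<close> with \<open>Card_order r\<close>
  (initial ordinals), compared across types by \<open>\<le>o\<close>, \<open><o\<close> and \<open>=o\<close>.
  Spaces are values of type \<open>'a topology\<close>.
\<close>

definition min_card :: "'c rel set \<Rightarrow> 'c rel" where
  "min_card R = (SOME r. r \<in> R \<and> (\<forall>r' \<in> R. r \<le>o r'))"

lemma min_card:
  assumes "R \<noteq> {}" and "\<And>r. r \<in> R \<Longrightarrow> Card_order r"
  shows "min_card R \<in> R" and "r \<in> R \<Longrightarrow> min_card R \<le>o r"
proof -
  have "\<forall>r \<in> R. Well_order r"
    using assms(2) unfolding card_order_on_def by blast
  then have "\<exists>r. r \<in> R \<and> (\<forall>r' \<in> R. r \<le>o r')"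
    using exists_minim_Well_order[OF assms(1)] by blast
  then have *: "min_card R \<in> R \<and> (\<forall>r' \<in> R. min_card R \<le>o r')"
    unfolding min_card_def by (rule someI_ex)
  then show "min_card R \<in> R" and "r \<in> R \<Longrightarrow> min_card R \<le>o r" by blast+
qed

subsection \<open>Weight\<close>

definition base_of :: "'a topology \<Rightarrow> 'a set set \<Rightarrow> bool" where
  "base_of X \<B> \<longleftrightarrow>
     (\<forall>V\<in>\<B>. openin X V) \<and>
     (\<forall>U x. openin X U \<and> x \<in> U \<longrightarrow> (\<exists>V\<in>\<B>. x \<in> V \<and> V \<subseteq> U))"

definition weight :: "'a topology \<Rightarrow> 'a set rel" where
  "weight X = min_card {|\<B>| | \<B>. base_of X \<B>}"

lemma weight:
  shows "\<exists>\<B>. base_of X \<B> \<and> weight X = |\<B>|" and "base_of X \<B> \<Longrightarrow> weight X \<le>o |\<B>|"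
proof -
  let ?R = "{|\<B>| | \<B>. base_of X \<B>}"
  have "base_of X {U. openin X U}"
    unfolding base_of_def by blast
  then have ne: "?R \<noteq> {}" by blast
  have card: "Card_order r" if "r \<in> ?R" for r
    using that card_of_Card_order by auto
  show "\<exists>\<B>. base_of X \<B> \<and> weight X = |\<B>|"
    using min_card(1)[OF ne card] unfolding weight_def by blast
  show "base_of X \<B> \<Longrightarrow> weight X \<le>o |\<B>|"
    using min_card(2)[OF ne card] unfolding weight_def by blast
qed

subsection \<open>The Suslinian number\<close>

definition continuum_space :: "'a topology \<Rightarrow> bool" where
  "continuum_space K \<longleftrightarrow> compact_space K \<and> connected_space K \<and> Hausdorff_space K"

definition nondegenerate_subcontinuum :: "'a topology \<Rightarrow> 'a set \<Rightarrow> bool" where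
  "nondegenerate_subcontinuum K C \<longleftrightarrow>
     C \<subseteq> topspace K \<and> continuum_space (subtopology K C) \<and> (\<exists>x\<in>C. \<exists>y\<in>C. x \<noteq> y)"

text \<open>
  The supremum of the cardinalities of the disjoint families is their least upper bound among
  the cardinals; the bound \<open>natLeq\<close> (\<open>\<aleph>\<^sub>0\<close>) is the convention that the value is infinite.
  The type \<open>'k + nat\<close> is infinite and has at least as many elements as any of the families,
  so it carries a copy of the supremum.
\<close>

definition continuum_Sln :: "'k topology \<Rightarrow> ('k + nat) rel" where
  "continuum_Sln K = min_card {\<kappa>. Card_order \<kappa> \<and> natLeq \<le>o \<kappa> \<and>
     (\<forall>\<C>. disjoint \<C> \<and> (\<forall>C\<in>\<C>. nondegenerate_subcontinuum K C) \<longrightarrow> |\<C>| \<le>o \<kappa>)}"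

text \<open>
  \<open>Sln TYPE('k) X\<close> minimizes over the continua containing \<open>X\<close> whose points are drawn from the
  type \<open>('a, 'k) ambient\<close>, since HOL cannot quantify over all types. The type \<open>'k\<close> is
  arbitrary, so that statements for all \<open>'k\<close> cover continua of any size, and the
  minimum is the absolute one as soon as \<open>'k\<close> is large enough to host a continuum attaining it.
  The first summand hosts a Tychonoff cube containing \<open>X\<close>, so the minimum is never over an
  empty set when \<open>X\<close> is a Tychonoff space (lemma \<open>Sln\<close> below).
\<close>

type_synonym ('a, 'k) ambient = "(('a \<Rightarrow> real) \<Rightarrow> real) + 'k"

definition continuum_containing :: "'a topology \<Rightarrow> 'k topology \<Rightarrow> bool" where
  "continuum_containing X K \<longleftrightarrow> continuum_space K \<and> (\<exists>e. embedding_map X K e)"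

definition Sln :: "'k itself \<Rightarrow> 'a topology \<Rightarrow> (('a, 'k) ambient + nat) rel" where
  "Sln _ X = min_card {continuum_Sln K | K :: ('a, 'k) ambient topology. continuum_containing X K}"

lemma card_of_disjoint_le:
  fixes \<C> :: "'k set set"
  assumes "disjoint \<C>" and "{} \<notin> \<C>"
  shows "|\<C>| \<le>o |UNIV :: ('k + nat) set|"
proof -
  define f where "f C = (Inl (SOME x. x \<in> C) :: 'k + nat)" for C
  have some: "(SOME x. x \<in> C) \<in> C" if "C \<in> \<C>" for C
    using that assms(2) by (metis some_in_eq)
  have "inj_on f \<C>"
  proof (rule inj_onI)
    fix C D assume CD: "C \<in> \<C>" "D \<in> \<C>" "f C = f D"
    then have "C \<inter> D \<noteq> {}"
      using some[of C] some[of D] unfolding f_def by auto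
    then show "C = D"
      using CD assms(1) unfolding pairwise_def disjnt_def by blast
  qed
  then show ?thesis
    unfolding card_of_ordLeq[symmetric] by blast
qed

lemma continuum_Sln:
  shows "Card_order (continuum_Sln K)" and "natLeq \<le>o continuum_Sln K"
    and "disjoint \<C> \<Longrightarrow> (\<And>C. C \<in> \<C> \<Longrightarrow> nondegenerate_subcontinuum K C) \<Longrightarrow> |\<C>| \<le>o continuum_Sln K"
proof -
  let ?R = "{\<kappa> :: ('a + nat) rel. Card_order \<kappa> \<and> natLeq \<le>o \<kappa> \<and>
     (\<forall>\<C>. disjoint \<C> \<and> (\<forall>C\<in>\<C>. nondegenerate_subcontinuum K C) \<longrightarrow> |\<C>| \<le>o \<kappa>)}"
  have "natLeq \<le>o |UNIV :: ('a + nat) set|"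
    by (metis infinite_iff_natLeq_ordLeq finite_Plus_UNIV_iff infinite_UNIV_nat)
  then have "|UNIV :: ('a + nat) set| \<in> ?R"
    using card_of_disjoint_le[where ?'k = 'a] card_of_Card_order
    by (fastforce simp: nondegenerate_subcontinuum_def)
  then have "continuum_Sln K \<in> ?R"
    unfolding continuum_Sln_def using min_card(1)[of ?R] by blast
  then show "Card_order (continuum_Sln K)" and "natLeq \<le>o continuum_Sln K"
    and "disjoint \<C> \<Longrightarrow> (\<And>C. C \<in> \<C> \<Longrightarrow> nondegenerate_subcontinuum K C) \<Longrightarrow> |\<C>| \<le>o continuum_Sln K"
    by blast+
qed

lemma homeomorphic_copy_Inl:
  fixes X :: "'a topology"
  shows "X homeomorphic_space pullback_topology (range Inl) projl X"
proof -
  have "continuous_map X (pullback_topology (range Inl) projl X) Inl"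
    by (rule continuous_map_pullback') (auto simp: comp_def)
  moreover have "continuous_map (pullback_topology (range Inl) projl X) X projl"
    using continuous_map_pullback[of X X id] by simp
  ultimately show ?thesis
    unfolding homeomorphic_space_def homeomorphic_maps_def
    by (intro exI[of _ Inl] exI[of _ projl]) (auto simp: topspace_pullback_topology)
qed

lemma ex_continuum_containing:
  fixes X :: "'a topology"
  assumes "completely_regular_space X" and "Hausdorff_space X"
  shows "\<exists>K :: ('a, 'k) ambient topology. continuum_containing X K"
proof -
  obtain I :: "('a \<Rightarrow> real) set" and e
    where e: "embedding_map X (product_topology (\<lambda>f. top_of_set {0..1::real}) I) e"
    using completely_regular_space_cube_embedding[OF assms] by blast
  define Q where "Q = product_topology (\<lambda>f. top_of_set {0..1::real}) I"
  define K :: "('a, 'k) ambient topology" where "K = pullback_topology (range Inl) projl Q"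
  have "connected_space (top_of_set {0..1::real})"
    using connectedin_def[of euclideanreal "{0..1}"] by simp
  then have "compact_space Q" "connected_space Q" "Hausdorff_space Q"
    unfolding Q_def
    by (auto simp: compact_space_product_topology connected_space_product_topology
        Hausdorff_space_product_topology compact_space_subtopology Hausdorff_space_subtopology)
  moreover have h: "Q homeomorphic_space K"
    unfolding K_def by (rule homeomorphic_copy_Inl)
  ultimately have "continuum_space K"
    unfolding continuum_space_def
    using homeomorphic_compact_space homeomorphic_connected_space homeomorphic_Hausdorff_space
    by blast
  moreover obtain g where "homeomorphic_map Q K g"
    using h homeomorphic_space by blast
  then have "embedding_map X K (g \<circ> e)"
    using e embedding_map_compose surjective_embedding_map unfolding Q_def by blast
  ultimately show ?thesis
    unfolding continuum_containing_def by blast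
qed

lemma Sln:
  fixes X :: "'a topology"
  assumes "completely_regular_space X" and "Hausdorff_space X"
  shows "\<exists>K :: ('a, 'k) ambient topology.
      continuum_containing X K \<and> Sln TYPE('k) X = continuum_Sln K"
    and "\<And>K :: ('a, 'k) ambient topology.
      continuum_containing X K \<Longrightarrow> Sln TYPE('k) X \<le>o continuum_Sln K"
proof -
  let ?R = "{continuum_Sln K | K :: ('a, 'k) ambient topology. continuum_containing X K}"
  have ne: "?R \<noteq> {}"
    using ex_continuum_containing[OF assms] by blast
  have card: "Card_order r" if "r \<in> ?R" for r
    using that continuum_Sln(1) by auto
  show "\<exists>K :: ('a, 'k) ambient topology.
      continuum_containing X K \<and> Sln TYPE('k) X = continuum_Sln K"
    using min_card(1)[OF ne card] unfolding Sln_def by blast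
  show "\<And>K :: ('a, 'k) ambient topology.
      continuum_containing X K \<Longrightarrow> Sln TYPE('k) X \<le>o continuum_Sln K"
    using min_card(2)[OF ne card] unfolding Sln_def by blast
qed

subsection \<open>Inverse spectra\<close>

text \<open>
  The index set is \<open>Field r\<close>, with \<open>(\<alpha>, \<beta>) \<in> r\<close> for \<open>\<alpha> \<le> \<beta>\<close>, and \<open>p \<alpha> \<beta>\<close> is the bonding
  map from \<open>Z \<beta>\<close> to \<open>Z \<alpha>\<close>. For \<open>r = cardSuc \<kappa>\<close>, an initial ordinal, the elements of
  \<open>Field r\<close> correspond in order to the ordinals below \<open>\<kappa>\<^sup>+\<close>.

  A Hausdorff space of weight at most \<open>\<kappa>\<close> has at most \<open>2\<^sup>\<kappa>\<close> points, and an infinite compact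
  Hausdorff space \<open>X :: 'a topology\<close> has at least as many points as its weight. So if
  \<open>\<kappa> <o weight X\<close>, spectra of spaces of weight at most \<open>\<kappa>\<close> can be taken, up to
  homeomorphism, with \<open>'z = 'a set\<close>.
\<close>

definition inverse_spectrum ::
    "'i rel \<Rightarrow> ('i \<Rightarrow> 'z topology) \<Rightarrow> ('i \<Rightarrow> 'i \<Rightarrow> 'z \<Rightarrow> 'z) \<Rightarrow> bool" where
  "inverse_spectrum r Z p \<longleftrightarrow>
     (\<forall>\<alpha> \<beta>. (\<alpha>, \<beta>) \<in> r \<longrightarrow> continuous_map (Z \<beta>) (Z \<alpha>) (p \<alpha> \<beta>)) \<and>
     (\<forall>\<alpha> \<in> Field r. \<forall>z \<in> topspace (Z \<alpha>). p \<alpha> \<alpha> z = z) \<and>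
     (\<forall>\<alpha> \<beta> \<gamma>. (\<alpha>, \<beta>) \<in> r \<and> (\<beta>, \<gamma>) \<in> r \<longrightarrow>
        (\<forall>z \<in> topspace (Z \<gamma>). p \<alpha> \<beta> (p \<beta> \<gamma> z) = p \<alpha> \<gamma> z))"

definition inverse_limit ::
    "'i rel \<Rightarrow> ('i \<Rightarrow> 'z topology) \<Rightarrow> ('i \<Rightarrow> 'i \<Rightarrow> 'z \<Rightarrow> 'z) \<Rightarrow> ('i \<Rightarrow> 'z) topology" where
  "inverse_limit r Z p = subtopology (product_topology Z (Field r))
     {z. \<forall>\<alpha> \<beta>. (\<alpha>, \<beta>) \<in> r \<longrightarrow> p \<alpha> \<beta> (z \<beta>) = z \<alpha>}"

end

theory Submission
  imports Defs
begin

text \<open>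
  Let \<open>K\<close> be a continuum containing \<open>X\<close> whose Suslinian number \<open>\<kappa>\<close> is that of \<open>X\<close>. Every set \<open>\<Phi>\<close> of
  continuous real functions on \<open>K\<close> decomposes \<open>K\<close> into the connected components of the common fibres
  of \<open>\<Phi>\<close>: this is the monotone factor of the diagonal map of \<open>\<Phi>\<close>. The spectrum consists of the
  quotients of \<open>X\<close> by such decompositions, for an increasing family of sets \<open>\<Phi> \<alpha>\<close>, \<open>\<alpha> < \<kappa>\<^sup>+\<close>, of size
  at most \<open>\<kappa>\<close>. Three facts make this work.

  First, passing from fibres to their components does not raise the weight above \<open>\<kappa>\<close>
  (\<open>separating_opens_fibre_component\<close>). If \<open>A\<close> is a proper closed subset of \<open>K\<close> and \<open>V \<subseteq> A\<close> is open, then by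
  boundary bumping the components of \<open>A\<close> that meet \<open>V\<close> are nondegenerate, and there are at most \<open>\<kappa>\<close> of
  them. One clopen partition of \<open>A\<close> for each pair of these components is therefore enough. When \<open>A\<close>
  runs through closed neighbourhoods of fibres taken from a family of size \<open>\<kappa>\<close>, these partitions
  separate any two components of any fibre.

  Second, one can keep the pieces from straddling \<open>X\<close> (\<open>ex_shielding_functions\<close>). Take a maximal
  disjoint family of nondegenerate subcontinua of \<open>K\<close> missing \<open>X\<close> and functions separating each of
  them from \<open>X\<close>. A connected piece of a fibre that meets \<open>X\<close> misses all these subcontinua; if it left \<open>X\<close>
  it would contain a further subcontinuum missing \<open>X\<close>, against maximality. So the pieces meeting \<open>X\<close>
  are subsets of \<open>X\<close>, and the connectedness of the pieces of \<open>K\<close> is inherited by the fibres of the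
  quotient maps of \<open>X\<close>.

  Third, if \<open>\<Phi> \<beta>\<close> contains for every \<open>\<alpha> < \<beta>\<close> a function nonconstant on each nondegenerate piece of
  \<open>\<Phi> \<alpha>\<close>, then all the \<open>\<Phi> \<alpha>\<close> together separate points (\<open>ex_tower_of_decompositions\<close>). Two points never
  separated would lie in a strictly decreasing sequence of pieces of length \<open>\<kappa>\<^sup>+\<close>. Each piece
  minus the later ones contains a nondegenerate subcontinuum, which gives \<open>\<kappa>\<^sup>+\<close> disjoint ones.

  Quotients of a compact space that become finer along a well-order, have connected fibres and
  jointly separate points form an inverse spectrum with monotone bonding maps and limit \<open>X\<close>
  (\<open>inverse_limit_of_quotients\<close>).
\<close>

section \<open>Cardinal bounds\<close>

lemma image_bound: "|A| \<le>o \<kappa> \<Longrightarrow> |f ` A| \<le>o \<kappa>"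
  using card_of_image ordLeq_transitive by blast

lemma subset_bound: "A \<subseteq> B \<Longrightarrow> |B| \<le>o \<kappa> \<Longrightarrow> |A| \<le>o \<kappa>"
  using card_of_mono1 ordLeq_transitive by blast

lemma Fpow_Cinfinite_bound:
  assumes "|A| \<le>o \<kappa>" and \<kappa>: "Cinfinite \<kappa>"
  shows "|Fpow A| \<le>o \<kappa>"
proof -
  have "|{B. B \<subseteq> A \<and> finite B \<and> card B = n}| \<le>o \<kappa>" for n
  proof (induction n)
    case 0
    have "{B. B \<subseteq> A \<and> finite B \<and> card B = 0} = (\<lambda>n. {}) ` {0::nat}"
      by auto
    moreover have "|{0::nat}| \<le>o \<kappa>"
      using \<kappa> Card_order_singl_ordLeq[of \<kappa>] unfolding cinfinite_def by force
    ultimately show ?case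
      using image_bound by metis
  next
    case (Suc n)
    let ?F = "{B. B \<subseteq> A \<and> finite B \<and> card B = n}"
    have "{B. B \<subseteq> A \<and> finite B \<and> card B = Suc n} \<subseteq> (\<lambda>(a, B). insert a B) ` (A \<times> ?F)"
    proof
      fix B assume B: "B \<in> {B. B \<subseteq> A \<and> finite B \<and> card B = Suc n}"
      then obtain a B' where "B = insert a B'" "a \<notin> B'" "card B' = n"
        using card_Suc_eq[of B n] by blast
      then show "B \<in> (\<lambda>(a, B). insert a B) ` (A \<times> ?F)"
        using B by (intro image_eqI[of _ _ "(a, B')"]) auto
    qed
    moreover have "|A \<times> ?F| \<le>o \<kappa>"
      using assms Suc card_of_Times_ordLeq_infinite_Field unfolding cinfinite_def by blast
    ultimately show ?case
      using image_bound subset_bound by blast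
  qed
  moreover have "|UNIV :: nat set| \<le>o \<kappa>"
    using \<kappa> natLeq_ordLeq_cinfinite card_of_nat ordIso_ordLeq_trans by blast
  ultimately have "|\<Union>n. {B. B \<subseteq> A \<and> finite B \<and> card B = n}| \<le>o \<kappa>"
    by (intro UNION_Cinfinite_bound[OF _ _ \<kappa>] ballI)
  moreover have "Fpow A \<subseteq> (\<Union>n. {B. B \<subseteq> A \<and> finite B \<and> card B = n})"
    unfolding Fpow_def by auto
  ultimately show ?thesis
    using subset_bound by blast
qed

lemma Times_Cinfinite_bound:
  "|A| \<le>o \<kappa> \<Longrightarrow> |B| \<le>o \<kappa> \<Longrightarrow> Cinfinite \<kappa> \<Longrightarrow> |A \<times> B| \<le>o \<kappa>"
  unfolding cinfinite_def using card_of_Times_ordLeq_infinite_Field by blast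

lemma Cinfinite_continuum_Sln: "Cinfinite (continuum_Sln K)"
  using continuum_Sln(1,2)[of K] natLeq_cinfinite cinfinite_mono by blast

section \<open>Nondegenerate subcontinua\<close>

text \<open>
  A component of \<open>A\<close> reaches the frontier of \<open>A\<close>, by boundary bumping. An interior point of \<open>A\<close>
  lies off the frontier, so it cannot be the whole of its component.
\<close>

lemma nondegenerate_component:
  assumes K: "continuum_space K" and A: "closedin K A" "A \<noteq> topspace K"
    and U: "openin K U" "U \<subseteq> A" "x \<in> U"
  shows "nondegenerate_subcontinuum K (connected_component_of_set (subtopology K A) x)"
proof -
  let ?C = "connected_component_of_set (subtopology K A) x"
  have K': "compact_space K" "connected_space K" "Hausdorff_space K"
    using K unfolding continuum_space_def by auto
  have x: "x \<in> topspace (subtopology K A)"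
    using U openin_subset by fastforce
  then have C: "?C \<in> connected_components_of (subtopology K A)"
    by (simp add: connected_component_in_connected_components_of)
  have "closedin K ?C"
    using C A closedin_connected_components_of closedin_trans_full by blast
  moreover have "connectedin K ?C"
    using connectedin_connected_component_of[of "subtopology K A" x]
    by (simp add: connectedin_subtopology)
  moreover have "?C \<inter> K frontier_of A \<noteq> {}"
    using boundary_bumping_theorem_closed[OF K'(2,1,3) A C] .
  moreover have "x \<notin> K frontier_of A"
    using U interior_of_maximal unfolding frontier_of_def by fastforce
  moreover have "x \<in> ?C"
    using x connected_component_of_refl by fastforce
  ultimately obtain y where y: "y \<in> ?C" "y \<noteq> x" "x \<in> ?C"
    by (metis IntE ex_in_conv)
  have "compactin K ?C"
    using \<open>closedin K ?C\<close> K'(1) closedin_compact_space by blast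
  then show ?thesis
    using K' y \<open>connectedin K ?C\<close>
    by (auto simp: nondegenerate_subcontinuum_def continuum_space_def connectedin_def
        compactin_subspace Hausdorff_space_subtopology)
qed

text \<open>
  This is the source of disjoint subcontinua. Bumping inside \<open>F\<close> needs a closed neighbourhood \<open>A\<close> in \<open>F\<close> of a point
  off \<open>B\<close> that is not all of \<open>F\<close>; because \<open>F\<close> meets \<open>B\<close>, any \<open>A\<close> missing \<open>B\<close> will do.
\<close>

lemma subcontinuum_avoiding:
  assumes K: "Hausdorff_space K" and F: "compactin K F" "connectedin K F"
    and B: "closedin K B" "F \<inter> B \<noteq> {}" "\<not> F \<subseteq> B"
  obtains C where "nondegenerate_subcontinuum K C" "C \<subseteq> F - B"
proof -
  let ?F = "subtopology K F"
  have cF: "compact_space ?F" "connected_space ?F" "Hausdorff_space ?F"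
    using F K by (auto simp: compact_space_subtopology connectedin_def Hausdorff_space_subtopology)
  have FK: "F \<subseteq> topspace K" using F compactin_subset_topspace by blast
  obtain x where x: "x \<in> F" "x \<notin> B" using B by blast
  have "openin ?F (F - B)"
  proof -
    have "F - B = (topspace K - B) \<inter> F" using FK by blast
    then show ?thesis using B(1) by (metis closedin_def openin_subtopology)
  qed
  moreover have "regular_space ?F"
    using cF compact_Hausdorff_imp_regular_space by blast
  ultimately obtain U A where UA: "openin ?F U" "closedin ?F A" "x \<in> U" "U \<subseteq> A" "A \<subseteq> F - B"
    using x unfolding neighbourhood_base_of_closedin[symmetric] neighbourhood_base_of
    by (metis DiffI)
  have "A \<noteq> topspace ?F"
    using UA B FK by auto
  then have nd: "nondegenerate_subcontinuum ?F (connected_component_of_set (subtopology ?F A) x)"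
    using nondegenerate_component[of ?F A U x] UA cF unfolding continuum_space_def by blast
  let ?C = "connected_component_of_set (subtopology ?F A) x"
  have "?C \<subseteq> A" 
    using connected_component_of_subset_topspace by fastforce
  then have CF: "?C \<subseteq> F - B" using UA by blast
  moreover have "nondegenerate_subcontinuum K ?C"
    using nd CF FK unfolding nondegenerate_subcontinuum_def
    by (auto simp: subtopology_subtopology inf_absorb2 subset_iff)
  ultimately show ?thesis using that by blast
qed

section \<open>Separation by saturated open sets\<close>

text \<open>
  Such a family witnesses that the quotient of \<open>K\<close> by the fibres of \<open>q\<close> is Hausdorff, and for compact
  \<open>K\<close> every infinite cardinal bounding its size bounds the weight of the quotient. Stating it on \<open>K\<close> itself, for an arbitrary function
  \<open>q\<close>, lets decompositions be refined and restricted before any quotient space is formed.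
\<close>

definition separating_opens :: "'k topology \<Rightarrow> ('k \<Rightarrow> 'z) \<Rightarrow> 'k set set \<Rightarrow> bool" where
  "separating_opens K q \<V> \<longleftrightarrow>
     (\<forall>V\<in>\<V>. openin K V \<and> (\<forall>x\<in>V. \<forall>y\<in>topspace K. q y = q x \<longrightarrow> y \<in> V)) \<and>
     (\<forall>x\<in>topspace K. \<forall>y\<in>topspace K. q x \<noteq> q y \<longrightarrow> (\<exists>U\<in>\<V>. \<exists>V\<in>\<V>. x \<in> U \<and> y \<in> V \<and> disjnt U V))"

lemma separating_opensD:
  assumes "separating_opens K q \<V>"
  shows "V \<in> \<V> \<Longrightarrow> openin K V"
    and "V \<in> \<V> \<Longrightarrow> x \<in> V \<Longrightarrow> y \<in> topspace K \<Longrightarrow> q y = q x \<Longrightarrow> y \<in> V"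
    and "x \<in> topspace K \<Longrightarrow> y \<in> topspace K \<Longrightarrow> q x \<noteq> q y \<Longrightarrow>
      \<exists>U V. U \<in> \<V> \<and> V \<in> \<V> \<and> x \<in> U \<and> y \<in> V \<and> disjnt U V"
  using assms unfolding separating_opens_def by blast+

lemma closedin_separated_fibre:
  assumes "separating_opens K q \<V>"
  shows "closedin K {y \<in> topspace K. q y = q x}"
proof (cases "{y \<in> topspace K. q y = q x} = {}")
  case False
  then obtain y where y: "y \<in> topspace K" "q y = q x" by blast
  have "openin K (topspace K - {y \<in> topspace K. q y = q x})"
  proof (subst openin_subopen, intro ballI)
    fix z assume z: "z \<in> topspace K - {y \<in> topspace K. q y = q x}"
    then obtain U V where UV: "U \<in> \<V>" "V \<in> \<V>" "z \<in> U" "y \<in> V" "disjnt U V"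
      using separating_opensD(3)[OF assms, of z y] y by auto
    have "U \<subseteq> topspace K - {y \<in> topspace K. q y = q x}"
    proof
      fix u assume u: "u \<in> U"
      then have "u \<in> topspace K"
        using UV separating_opensD(1)[OF assms] openin_subset by blast
      moreover have "q u \<noteq> q x"
        using separating_opensD(2)[OF assms UV(2,4), of u] u UV y \<open>u \<in> topspace K\<close>
        by (auto simp: disjnt_iff)
      ultimately show "u \<in> topspace K - {y \<in> topspace K. q y = q x}" by blast
    qed
    then show "\<exists>T. openin K T \<and> z \<in> T \<and> T \<subseteq> topspace K - {y \<in> topspace K. q y = q x}"
      using UV separating_opensD(1)[OF assms] by blast
  qed
  then show ?thesis by (simp add: closedin_def)
qed (metis closedin_empty)

text \<open>
  Cover the compact complement of \<open>W\<close> by members of \<open>\<V>\<close>, each disjoint from another member around \<open>x\<close>.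
  The intersection of the finitely many members around \<open>x\<close> is squeezed into \<open>W\<close> by the complement of the
  finite subcover, which is closed and saturated. Both sets are indexed by \<open>Fpow \<V>\<close>, so every
  infinite cardinal bounding \<open>|\<V>|\<close> also bounds the number of pairs of such sets.
\<close>

lemma separating_opens_neighbourhood:
  assumes K: "compact_space K" and \<V>: "separating_opens K q \<V>"
    and W: "openin K W" "x \<in> topspace K" "{y \<in> topspace K. q y = q x} \<subseteq> W"
  obtains S T where "S \<in> Fpow \<V>" "T \<in> Fpow \<V>" "x \<in> \<Inter>S"
    "topspace K \<inter> \<Inter>S \<subseteq> topspace K - \<Union>T" "topspace K - \<Union>T \<subseteq> W"
proof -
  have "\<forall>y\<in>topspace K - W. \<exists>U V. U \<in> \<V> \<and> V \<in> \<V> \<and> x \<in> U \<and> y \<in> V \<and> disjnt U V"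
  proof
    fix y assume "y \<in> topspace K - W"
    then show "\<exists>U V. U \<in> \<V> \<and> V \<in> \<V> \<and> x \<in> U \<and> y \<in> V \<and> disjnt U V"
      using W by (intro separating_opensD(3)[OF \<V>]) auto
  qed
  then obtain u v where uv: "\<And>y. y \<in> topspace K - W \<Longrightarrow>
      u y \<in> \<V> \<and> v y \<in> \<V> \<and> x \<in> u y \<and> y \<in> v y \<and> disjnt (u y) (v y)"
    by metis
  have "compactin K (topspace K - W)"
    using K W closedin_compact_space by blast
  moreover have "\<forall>V\<in>v ` (topspace K - W). openin K V"
    using uv separating_opensD(1)[OF \<V>] by blast
  moreover have "topspace K - W \<subseteq> \<Union>(v ` (topspace K - W))"
    using uv by blast
  ultimately obtain T where "finite T" "T \<subseteq> v ` (topspace K - W)" "topspace K - W \<subseteq> \<Union>T"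
    unfolding compactin_def by meson
  then obtain Y where Y: "finite Y" "Y \<subseteq> topspace K - W" "topspace K - W \<subseteq> \<Union>(v ` Y)"
    by (metis finite_subset_image)
  show ?thesis
  proof
    show "u ` Y \<in> Fpow \<V>" "v ` Y \<in> Fpow \<V>"
      using Y uv unfolding Fpow_def by auto
    show "x \<in> \<Inter>(u ` Y)" using Y uv by blast
    show "topspace K - \<Union>(v ` Y) \<subseteq> W" using Y by blast
    show "topspace K \<inter> \<Inter>(u ` Y) \<subseteq> topspace K - \<Union>(v ` Y)"
      using Y uv unfolding disjnt_iff by blast
  qed
qed

lemma openin_Fpow_Inter:
  "\<forall>V\<in>\<V>. openin K V \<Longrightarrow> S \<in> Fpow \<V> \<Longrightarrow> openin K (topspace K \<inter> \<Inter>S)"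
  unfolding Fpow_def by (cases "S = {}") (auto intro!: openin_Int openin_Inter)

section \<open>Components of fibres\<close>

text \<open>
  For continuous \<open>q\<close> on a compact Hausdorff space, with values in a Hausdorff space, the map \<open>fibre_component K q\<close> is the monotone factor in the monotone-light
  factorization of \<open>q\<close>, with the points of the middle space represented by the fibres.
\<close>

definition fibre_component :: "'k topology \<Rightarrow> ('k \<Rightarrow> 'z) \<Rightarrow> 'k \<Rightarrow> 'k set" where
  "fibre_component K q x = connected_component_of_set (subtopology K {y \<in> topspace K. q y = q x}) x"

lemma fibre_component_refl: "x \<in> topspace K \<Longrightarrow> x \<in> fibre_component K q x"
  unfolding fibre_component_def using connected_component_of_refl by fastforce

lemma fibre_component_subset: "fibre_component K q x \<subseteq> {y \<in> topspace K. q y = q x}"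
  unfolding fibre_component_def using connected_component_of_subset_topspace by fastforce

lemma fibre_component_eq:
  assumes "y \<in> fibre_component K q x" shows "fibre_component K q y = fibre_component K q x"
proof -
  have q: "q y = q x" using assms fibre_component_subset by fast
  have "connected_component_of (subtopology K {y \<in> topspace K. q y = q x}) x y"
    using assms unfolding fibre_component_def by simp
  then have "connected_component_of (subtopology K {y \<in> topspace K. q y = q x}) x =
      connected_component_of (subtopology K {y \<in> topspace K. q y = q x}) y"
    by (meson connected_component_of_equiv)
  then show ?thesis unfolding fibre_component_def q by simp
qed

lemma connectedin_fibre_component: "connectedin K (fibre_component K q x)"
  unfolding fibre_component_def
  by (metis connectedin_connected_component_of connectedin_subtopology)

lemma fibre_component_maximal:
  assumes "connectedin K C" "x \<in> C" "\<And>y. y \<in> C \<Longrightarrow> q y = q x"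
  shows "C \<subseteq> fibre_component K q x"
  unfolding fibre_component_def
proof (rule connected_component_of_maximal)
  have "C \<subseteq> topspace K"
    using assms(1) connectedin_subset_topspace by metis
  then show "connectedin (subtopology K {y \<in> topspace K. q y = q x}) C"
    unfolding connectedin_subtopology using assms by blast
qed (use assms in blast)

lemma closedin_fibre_component:
  assumes "separating_opens K q \<V>"
  shows "closedin K (fibre_component K q x)"
  unfolding fibre_component_def
  using closedin_trans_full[OF closedin_connected_component_of closedin_separated_fibre[OF assms]] .

lemma nondegenerate_fibre_component:
  assumes "continuum_space K" "separating_opens K q \<V>" "x \<in> topspace K" "fibre_component K q x \<noteq> {x}"
  shows "nondegenerate_subcontinuum K (fibre_component K q x)"
proof -
  let ?C = "fibre_component K q x"
  have "compactin K ?C"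
    using assms closedin_fibre_component closedin_compact_space unfolding continuum_space_def by metis
  moreover have "x \<in> ?C"
    using fibre_component_refl assms(3) by fast
  moreover obtain y where "y \<in> ?C" "y \<noteq> x"
    using assms(4) \<open>x \<in> ?C\<close> by blast
  ultimately show ?thesis
    using assms connectedin_fibre_component[of K q x]
    by (auto simp: nondegenerate_subcontinuum_def continuum_space_def connectedin_def
        compactin_subspace Hausdorff_space_subtopology)
qed

lemma disjoint_fibre_components: "disjoint (range (fibre_component K q))"
  unfolding pairwise_def disjnt_iff using fibre_component_eq by (metis rangeE)

lemma connectedin_disjoint_open_cover:
  assumes "connectedin K C" "openin K G" "openin K H" "disjnt G H" "C \<subseteq> G \<union> H"
    "x \<in> C" "x \<in> G" "y \<in> C"
  shows "y \<notin> H"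
  using assms unfolding connectedin disjnt_def by blast

text \<open>
  By boundary bumping only \<open>continuum_Sln K\<close> components of a proper closed set need to be told apart
  near an open subset of it. If \<open>Y\<close> and \<open>Z\<close> are the spaces of components and of fibres, so that
  \<open>Y \<rightarrow> Z\<close> is the light factor of \<open>q\<close>, the conclusion amounts to \<open>w(Y) \<le> Sln(K) \<cdot> w(Z)\<close>.
\<close>

lemma separating_opens_fibre_component:
  assumes K: "continuum_space K" and \<V>: "separating_opens K q \<V>" "|\<V>| \<le>o continuum_Sln K"
  obtains \<W> where "separating_opens K (fibre_component K q) \<W>" "|\<W>| \<le>o continuum_Sln K"
proof -
  let ?\<kappa> = "continuum_Sln K"
  have K': "compact_space K" "connected_space K" "Hausdorff_space K"
    using K unfolding continuum_space_def by auto
  have op: "\<forall>V\<in>\<V>. openin K V" 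
    using separating_opensD(1)[OF \<V>(1)] by blast
  define V where "V S = topspace K \<inter> \<Inter>S" for S :: "'a set set"
  define A where "A T = topspace K - \<Union>T" for T :: "'a set set"
  have V: "openin K (V S)" if "S \<in> Fpow \<V>" for S
    using openin_Fpow_Inter[OF op that] unfolding V_def .
  have A: "closedin K (A T)" if "T \<in> Fpow \<V>" for T
    using op that unfolding A_def Fpow_def by (auto intro!: closedin_diff)
  have Vsat: "y \<in> V S" if "S \<in> Fpow \<V>" "x \<in> V S" "y \<in> topspace K" "q y = q x" for S x y
    using that separating_opensD(2)[OF \<V>(1)] unfolding V_def Fpow_def by blast
  have TA: "topspace (subtopology K (A T)) = A T" for T 
    unfolding A_def by auto
  (* The index (S, T) stands for an open V S inside a proper closed A T. Properness of A T is what
     makes boundary bumping applicable. *)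
  define I where "I = {i. fst i \<in> Fpow \<V> \<and> snd i \<in> Fpow \<V> \<and> V (fst i) \<subseteq> A (snd i) \<and> A (snd i) \<noteq> topspace K}"
  have ID: "fst i \<in> Fpow \<V>" "snd i \<in> Fpow \<V>" "V (fst i) \<subseteq> A (snd i)" "A (snd i) \<noteq> topspace K"
    if "i \<in> I" for i
    using that unfolding I_def by simp_all
  define \<C> where "\<C> i = connected_component_of_set (subtopology K (A (snd i))) ` V (fst i)" for i
  define P where "P i = {(C, C'). C \<in> \<C> i \<and> C' \<in> \<C> i \<and> C \<noteq> C'}" for i
  have "\<exists>D. closedin (subtopology K (A (snd i))) D \<and> openin (subtopology K (A (snd i))) D \<and>
      fst c \<subseteq> D \<and> snd c \<subseteq> A (snd i) - D" if "i \<in> I" "c \<in> P i" for i c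
  proof -
    let ?A = "subtopology K (A (snd i))"
    have "fst c \<in> \<C> i" "snd c \<in> \<C> i" and ne: "fst c \<noteq> snd c"
      using that unfolding P_def by auto
    then have c: "fst c \<in> connected_components_of ?A" "snd c \<in> connected_components_of ?A"
      using ID(3)[OF that(1)] unfolding \<C>_def connected_components_of_def TA by blast+
    then have "disjnt (fst c) (snd c)"
      using ne pairwise_disjoint_connected_components_of pairwiseD by metis
    moreover have "compact_space ?A" "Hausdorff_space ?A"
      using K' closedin_compact_space[OF K'(1) A[OF ID(2)[OF that(1)]]]
      by (auto simp: compact_space_subtopology Hausdorff_space_subtopology)
    then have "quasi_components_of ?A = connected_components_of ?A"
      by (simp add: quasi_eq_connected_components_of)
    ultimately have "separated_between ?A (fst c) (snd c)"
      using c separated_between_quasi_components[of "fst c" ?A "snd c"] by simp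
    then show ?thesis
      unfolding separated_between TA .
  qed
  then obtain D where D: "\<And>i c. i \<in> I \<Longrightarrow> c \<in> P i \<Longrightarrow> closedin (subtopology K (A (snd i))) (D i c) \<and>
      openin (subtopology K (A (snd i))) (D i c) \<and> fst c \<subseteq> D i c \<and> snd c \<subseteq> A (snd i) - D i c"
    by metis
  (* Intersecting with V S, which is saturated for q, makes both halves of the partition D open in K. *)
  define \<W> where "\<W> = \<V> \<union> (\<Union>i\<in>I. (\<lambda>c. V (fst i) \<inter> D i c) ` P i \<union> (\<lambda>c. V (fst i) - D i c) ` P i)"
  show ?thesis
  proof
    have I: "|I| \<le>o ?\<kappa>"
    proof (rule subset_bound)
      show "I \<subseteq> Fpow \<V> \<times> Fpow \<V>" unfolding I_def by auto
      show "|Fpow \<V> \<times> Fpow \<V>| \<le>o ?\<kappa>"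
        by (intro Times_Cinfinite_bound Fpow_Cinfinite_bound Cinfinite_continuum_Sln \<V>)
    qed
    have C: "|\<C> i| \<le>o ?\<kappa>" if i: "i \<in> I" for i
    proof (rule continuum_Sln(3))
      have "\<C> i \<subseteq> connected_components_of (subtopology K (A (snd i)))"
        using i ID(3) unfolding \<C>_def connected_components_of_def TA by blast
      then show "disjoint (\<C> i)"
        using pairwise_disjoint_connected_components_of pairwise_subset by blast
      fix C assume "C \<in> \<C> i"
      then obtain x where "x \<in> V (fst i)" "C = connected_component_of_set (subtopology K (A (snd i))) x"
        unfolding \<C>_def by auto
      then show "nondegenerate_subcontinuum K C"
        using nondegenerate_component[OF K A _ V, of "snd i" "fst i" x] ID[OF i] by simp
    qed
    have P: "|P i| \<le>o ?\<kappa>" if i: "i \<in> I" for i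
    proof (rule subset_bound)
      show "P i \<subseteq> \<C> i \<times> \<C> i" unfolding P_def by auto
      show "|\<C> i \<times> \<C> i| \<le>o ?\<kappa>"
        using C[OF i] Times_Cinfinite_bound Cinfinite_continuum_Sln by blast
    qed
    show "|\<W>| \<le>o ?\<kappa>"
      unfolding \<W>_def
      by (intro Un_Cinfinite_bound UNION_Cinfinite_bound ballI image_bound P I \<V> Cinfinite_continuum_Sln)
    have fcV: "fibre_component K q x \<subseteq> V S" if "S \<in> Fpow \<V>" "x \<in> V S" for S x
      using fibre_component_subset[of K q x] Vsat[OF that] by blast
    have fc: "fibre_component K q x \<subseteq> D i c \<or> disjnt (fibre_component K q x) (D i c)" 
      if "i \<in> I" "c \<in> P i" "x \<in> V (fst i)" for i c x
    proof -
      have "fibre_component K q x \<subseteq> A (snd i)"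
        using fcV[OF ID(1)[OF that(1)] that(3)] ID(3)[OF that(1)] by (rule order_trans)
      then have "connectedin (subtopology K (A (snd i))) (fibre_component K q x)"
        by (simp add: connectedin_subtopology connectedin_fibre_component)
      then show ?thesis
        using D[OF that(1,2)] by (simp add: connectedin_clopen_cases)
    qed
    show "separating_opens K (fibre_component K q) \<W>"
      unfolding separating_opens_def
    proof (intro conjI ballI impI)
      fix W assume "W \<in> \<W>"
      then consider "W \<in> \<V>" | i c where "i \<in> I" "c \<in> P i" "W = V (fst i) \<inter> D i c"
        | i c where "i \<in> I" "c \<in> P i" "W = V (fst i) - D i c"
        unfolding \<W>_def by blast
      then show "openin K W"
      proof cases
        case 1 then show ?thesis using op by blast
      next
        case 2
        then obtain G where G: "openin K G" "D i c = G \<inter> A (snd i)"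
          using D[OF 2(1,2)] unfolding openin_subtopology by blast
        have "W = V (fst i) \<inter> G"
          using 2(3) G ID(3)[OF 2(1)] by blast
        then show ?thesis using G V[OF ID(1)[OF 2(1)]] by auto
      next
        case 3
        then have "closedin K (D i c)"
          using D[OF 3(1,2)] A[OF ID(2)[OF 3(1)]] closedin_trans_full by blast
        then show ?thesis using V[OF ID(1)[OF 3(1)]] 3(3) by auto
      qed
    next
      fix W x y assume "W \<in> \<W>" and x: "x \<in> W" and y: "y \<in> topspace K"
        and xy: "fibre_component K q y = fibre_component K q x"
      have yx: "y \<in> fibre_component K q x"
        using fibre_component_refl[OF y, of q] xy by simp
      then have q: "q y = q x"
        using fibre_component_subset by fast
      consider "W \<in> \<V>" | i c where "i \<in> I" "c \<in> P i" "W = V (fst i) \<inter> D i c"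
        | i c where "i \<in> I" "c \<in> P i" "W = V (fst i) - D i c"
        using \<open>W \<in> \<W>\<close> unfolding \<W>_def by blast
      then show "y \<in> W"
      proof cases
        case 1 then show ?thesis using separating_opensD(2)[OF \<V>(1)] x y q by blast
      next
        case 2
        then have xV: "x \<in> V (fst i)" "x \<in> D i c" using x by auto
        have "x \<in> fibre_component K q x"
          using xV fibre_component_refl unfolding V_def by fast
        then have "y \<in> D i c"
          using fc[OF 2(1,2) xV(1)] yx xV unfolding disjnt_iff by blast
        moreover have "y \<in> V (fst i)"
          using fcV[of "fst i" x] xV yx ID(1)[OF 2(1)] by blast
        ultimately show ?thesis using 2 by blast
      next
        case 3
        then have xV: "x \<in> V (fst i)" "x \<notin> D i c" using x by auto
        have "x \<in> fibre_component K q x"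
          using xV fibre_component_refl unfolding V_def by fast
        then have "y \<notin> D i c"
          using fc[OF 3(1,2) xV(1)] yx xV unfolding disjnt_iff by blast
        moreover have "y \<in> V (fst i)"
          using fcV[of "fst i" x] xV yx ID(1)[OF 3(1)] by blast
        ultimately show ?thesis using 3 by blast
      qed
    next
      fix x y assume x: "x \<in> topspace K" and y: "y \<in> topspace K"
        and xy: "fibre_component K q x \<noteq> fibre_component K q y"
      show "\<exists>U\<in>\<W>. \<exists>V\<in>\<W>. x \<in> U \<and> y \<in> V \<and> disjnt U V"
      proof (cases "q x = q y")
        case False
        then show ?thesis
          using separating_opensD(3)[OF \<V>(1) x y] unfolding \<W>_def by blast
      next
        case True
        let ?F = "{z \<in> topspace K. q z = q x}"
        let ?KF = "subtopology K ?F"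
        have clF: "closedin K ?F"
          using closedin_separated_fibre[OF \<V>(1)] .
        have "compact_space ?KF" "Hausdorff_space ?KF"
          using K' clF closedin_compact_space compact_space_subtopology Hausdorff_space_subtopology
          by blast+
        moreover have "\<not> connected_component_of ?KF x y"
          using xy fibre_component_eq[of y K q x] unfolding fibre_component_def by auto
        ultimately have "separated_between ?KF {x} {y}"
          using x y True unfolding separated_between_singletons
          by (auto simp: quasi_eq_connected_component_of)
        (* Components and quasi-components agree in the compact fibre, so it splits between x and y. *)
        then obtain F1 F2 where PQ: "closedin ?KF F1" "closedin ?KF F2" "F1 \<union> F2 = topspace ?KF"
          "disjnt F1 F2" "x \<in> F1" "y \<in> F2"
          unfolding separated_between_alt by blast
        moreover have "closedin K F1" "closedin K F2"
          using PQ clF closedin_trans_full by blast+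
        moreover have "normal_space K"
          using K' compact_Hausdorff_or_regular_imp_normal_space by blast
        ultimately obtain G H where GH: "openin K G" "openin K H" "F1 \<subseteq> G" "F2 \<subseteq> H" "disjnt G H"
          unfolding normal_space_def by meson
        have "?F \<subseteq> G \<union> H"
          using PQ GH by auto
        then obtain S T where ST: "S \<in> Fpow \<V>" "T \<in> Fpow \<V>" "x \<in> \<Inter>S" "V S \<subseteq> A T" "A T \<subseteq> G \<union> H"
          unfolding V_def A_def
          by (rule separating_opens_neighbourhood[OF K'(1) \<V>(1) openin_Un[OF GH(1,2)] x])
        have xV: "x \<in> V S" using ST x unfolding V_def by blast
        then have yV: "y \<in> V S" using Vsat[OF ST(1) _ y] True by simp
        (* Otherwise G and H would disconnect the continuum K. *)
        have "A T \<noteq> topspace K"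
        proof
          assume "A T = topspace K"
          then have "y \<notin> H"
            using connectedin_disjoint_open_cover[of K "topspace K" G H x y] GH ST PQ x y K'(2)
            by (auto simp: connectedin_topspace)
          then show False using PQ GH by blast
        qed
        then have i: "(S, T) \<in> I" using ST unfolding I_def by simp
        let ?c = "\<lambda>z. connected_component_of_set (subtopology K (A T)) z"
        have "x \<in> ?c x" "y \<in> ?c y"
          using xV yV ST(4) x y by (auto simp: connected_component_of_refl TA)
        have cx: "connectedin K (?c x)" "?c x \<subseteq> A T"
          using connectedin_connected_component_of[of "subtopology K (A T)" x]
          by (simp_all add: connectedin_subtopology)
        have "?c x \<subseteq> G \<union> H" "x \<in> G" "y \<in> H"
          using cx(2) ST(5) PQ GH by blast+
        then have "y \<notin> ?c x"
          using connectedin_disjoint_open_cover[OF cx(1) GH(1,2,5) _ \<open>x \<in> ?c x\<close>] by blast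
        then have c: "(?c x, ?c y) \<in> P (S, T)"
          using xV yV \<open>y \<in> ?c y\<close> unfolding P_def \<C>_def by auto
        have Dxy: "x \<in> D (S, T) (?c x, ?c y)" "y \<notin> D (S, T) (?c x, ?c y)"
          using D[OF i c] \<open>x \<in> ?c x\<close> \<open>y \<in> ?c y\<close> unfolding fst_conv snd_conv by blast+
        show ?thesis
        proof (intro bexI conjI)
          show "x \<in> V S \<inter> D (S, T) (?c x, ?c y)" "y \<in> V S - D (S, T) (?c x, ?c y)"
            using Dxy xV yV by simp_all
          show "disjnt (V S \<inter> D (S, T) (?c x, ?c y)) (V S - D (S, T) (?c x, ?c y))"
            by (auto simp: disjnt_iff)
          show "V S \<inter> D (S, T) (?c x, ?c y) \<in> \<W>" "V S - D (S, T) (?c x, ?c y) \<in> \<W>"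
            using i c unfolding \<W>_def by force+
        qed
      qed
    qed
  qed
qed

section \<open>Quotients and inverse limits\<close>

definition quotient_topology :: "'a topology \<Rightarrow> ('a \<Rightarrow> 'z) \<Rightarrow> 'z topology" where
  "quotient_topology X q =
     topology (\<lambda>U. U \<subseteq> q ` topspace X \<and> openin X {x \<in> topspace X. q x \<in> U})"

lemma openin_quotient_topology:
  "openin (quotient_topology X q) U \<longleftrightarrow> U \<subseteq> q ` topspace X \<and> openin X {x \<in> topspace X. q x \<in> U}"
proof -
  have "istopology (\<lambda>U. U \<subseteq> q ` topspace X \<and> openin X {x \<in> topspace X. q x \<in> U})"
    unfolding istopology_def
  proof (rule conjI; intro allI impI conjI)
    fix S T
    assume S: "S \<subseteq> q ` topspace X \<and> openin X {x \<in> topspace X. q x \<in> S}"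
      and T: "T \<subseteq> q ` topspace X \<and> openin X {x \<in> topspace X. q x \<in> T}"
    show "S \<inter> T \<subseteq> q ` topspace X" using S by blast
    have *: "{x \<in> topspace X. q x \<in> S \<inter> T} = {x \<in> topspace X. q x \<in> S} \<inter> {x \<in> topspace X. q x \<in> T}"
      by blast
    show "openin X {x \<in> topspace X. q x \<in> S \<inter> T}"
      unfolding * using S T by (intro openin_Int) simp_all
  next
    fix \<K> assume \<K>: "\<forall>K\<in>\<K>. K \<subseteq> q ` topspace X \<and> openin X {x \<in> topspace X. q x \<in> K}"
    show "\<Union>\<K> \<subseteq> q ` topspace X"
      by (rule Union_least) (use \<K> in simp)
    have "{x \<in> topspace X. q x \<in> \<Union>\<K>} = (\<Union>K\<in>\<K>. {x \<in> topspace X. q x \<in> K})"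
      by blast
    moreover have "openin X (\<Union>K\<in>\<K>. {x \<in> topspace X. q x \<in> K})"
      using \<K> by (intro openin_Union) blast
    ultimately show "openin X {x \<in> topspace X. q x \<in> \<Union>\<K>}" by simp
  qed
  then show ?thesis
    unfolding quotient_topology_def by (simp add: topology_inverse')
qed

lemma topspace_quotient_topology [simp]: "topspace (quotient_topology X q) = q ` topspace X"
proof -
  have "openin (quotient_topology X q) (q ` topspace X)"
    unfolding openin_quotient_topology by (auto simp: Collect_mem_eq cong: conj_cong)
  then show ?thesis
    by (metis openin_quotient_topology openin_subset openin_topspace subset_antisym)
qed

lemma quotient_map_quotient_topology: "quotient_map X (quotient_topology X q) q"
  unfolding quotient_map_def by (simp add: openin_quotient_topology)

lemma compact_space_quotient_topology:
  "compact_space X \<Longrightarrow> compact_space (quotient_topology X q)"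
  by (metis image_compactin compact_space_def quotient_imp_continuous_map
      quotient_map_quotient_topology topspace_quotient_topology)

lemma openin_quotient_image:
  assumes \<V>: "separating_opens X q \<V>" and S: "S \<in> Fpow \<V>"
  shows "openin (quotient_topology X q) (q ` (topspace X \<inter> \<Inter>S))"
proof -
  have "{x \<in> topspace X. q x \<in> q ` (topspace X \<inter> \<Inter>S)} = topspace X \<inter> \<Inter>S"
  proof -
    have "x \<in> \<Inter>S" if "x \<in> topspace X" "y \<in> topspace X \<inter> \<Inter>S" "q x = q y" for x y
    proof
      fix V assume "V \<in> S"
      then show "x \<in> V"
        using separating_opensD(2)[OF \<V>, of V y x] that S by (auto simp: Fpow_def)
    qed
    then show ?thesis by blast
  qed
  moreover have "openin X (topspace X \<inter> \<Inter>S)"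
    using openin_Fpow_Inter[OF _ S] separating_opensD(1)[OF \<V>] by blast
  ultimately show ?thesis
    unfolding openin_quotient_topology by auto
qed

lemma Hausdorff_space_quotient_topology:
  assumes \<V>: "separating_opens X q \<V>"
  shows "Hausdorff_space (quotient_topology X q)"
  unfolding Hausdorff_space_def topspace_quotient_topology
proof (intro allI impI)
  fix a b assume "a \<in> q ` topspace X \<and> b \<in> q ` topspace X \<and> a \<noteq> b"
  then obtain x y where xy: "x \<in> topspace X" "y \<in> topspace X" "a = q x" "b = q y" "q x \<noteq> q y"
    by blast
  then obtain U V where UV: "U \<in> \<V>" "V \<in> \<V>" "x \<in> U" "y \<in> V" "disjnt U V"
    using separating_opensD(3)[OF \<V>] by blast
  have "{U} \<in> Fpow \<V>" "{V} \<in> Fpow \<V>"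
    using UV unfolding Fpow_def by auto
  then have o: "openin (quotient_topology X q) (q ` (topspace X \<inter> \<Inter>{U}))"
     "openin (quotient_topology X q) (q ` (topspace X \<inter> \<Inter>{V}))"
    using openin_quotient_image[OF \<V>] by blast+
  have "disjnt (q ` (topspace X \<inter> \<Inter>{U})) (q ` (topspace X \<inter> \<Inter>{V}))"
  proof -
    have False if "u \<in> topspace X" "u \<in> U" "v \<in> V" "q u = q v" for u v
      using separating_opensD(2)[OF \<V> UV(2) that(3,1,4)] UV(5) that(2) by (auto simp: disjnt_iff)
    then show ?thesis unfolding disjnt_iff by auto
  qed
  moreover have "a \<in> q ` (topspace X \<inter> \<Inter>{U})" "b \<in> q ` (topspace X \<inter> \<Inter>{V})"
    using xy UV by auto
  ultimately show "\<exists>U V. openin (quotient_topology X q) U \<and> openin (quotient_topology X q) V \<and>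
      a \<in> U \<and> b \<in> V \<and> disjnt U V"
    using o by blast
qed

text \<open>
  The images of the finite intersections of members of \<open>\<V>\<close> form a base.
\<close>

lemma weight_quotient_topology:
  assumes X: "compact_space X" and \<V>: "separating_opens X q \<V>" "|\<V>| \<le>o \<kappa>" and \<kappa>: "Cinfinite \<kappa>"
  shows "weight (quotient_topology X q) \<le>o \<kappa>"
proof -
  let ?B = "(\<lambda>S. q ` (topspace X \<inter> \<Inter>S)) ` Fpow \<V>"
  have "base_of (quotient_topology X q) ?B"
    unfolding base_of_def
  proof (intro conjI ballI allI impI)
    show "openin (quotient_topology X q) V" if "V \<in> ?B" for V
      using that openin_quotient_image[OF \<V>(1)] by blast
    fix U z assume Uz: "openin (quotient_topology X q) U \<and> z \<in> U"
    then obtain x where x: "x \<in> topspace X" "z = q x" and U: "openin X {x \<in> topspace X. q x \<in> U}"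
      unfolding openin_quotient_topology by blast
    have "{y \<in> topspace X. q y = q x} \<subseteq> {x \<in> topspace X. q x \<in> U}"
      using Uz x by auto
    then obtain S T where ST: "S \<in> Fpow \<V>" "x \<in> \<Inter>S" "topspace X \<inter> \<Inter>S \<subseteq> topspace X - \<Union>T"
      "topspace X - \<Union>T \<subseteq> {x \<in> topspace X. q x \<in> U}"
      by (rule separating_opens_neighbourhood[OF X \<V>(1) U x(1)])
    then have "q ` (topspace X \<inter> \<Inter>S) \<subseteq> U" "z \<in> q ` (topspace X \<inter> \<Inter>S)"
      using x by blast+
    then show "\<exists>V\<in>?B. z \<in> V \<and> V \<subseteq> U"
      using ST(1) by blast
  qed
  then have "weight (quotient_topology X q) \<le>o |?B|"
    by (rule weight(2))
  moreover have "|?B| \<le>o \<kappa>"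
    by (intro image_bound Fpow_Cinfinite_bound \<V> \<kappa>)
  ultimately show ?thesis
    by (rule ordLeq_transitive)
qed

text \<open>
  The bonding maps are forced by \<open>\<pi> \<alpha> \<beta> \<circ> q \<beta> = q \<alpha>\<close>. Their fibres are the \<open>q \<beta>\<close>-images of the fibres of
  \<open>q \<alpha>\<close>, hence connected. A thread of the spectrum corresponds to a chain of nonempty closed subsets of
  \<open>X\<close>, which has a common point by compactness; so the canonical map from \<open>X\<close> to the limit is a
  continuous bijection from a compact space to a Hausdorff one.
\<close>

lemma inverse_limit_of_quotients:
  fixes r :: "'i rel" and X :: "'a topology" and q :: "'i \<Rightarrow> 'a \<Rightarrow> 'z"
  assumes X: "compact_space X" and r: "Well_order r" "r \<noteq> {}"
    and q: "\<And>\<alpha>. \<alpha> \<in> Field r \<Longrightarrow> quotient_map X (Z \<alpha>) (q \<alpha>)"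
    and Z: "\<And>\<alpha>. \<alpha> \<in> Field r \<Longrightarrow> Hausdorff_space (Z \<alpha>)"
    and fibres: "\<And>\<alpha> z. \<alpha> \<in> Field r \<Longrightarrow> z \<in> topspace (Z \<alpha>) \<Longrightarrow> connectedin X {x \<in> topspace X. q \<alpha> x = z}"
    and finer: "\<And>\<alpha> \<beta> x y. (\<alpha>, \<beta>) \<in> r \<Longrightarrow> x \<in> topspace X \<Longrightarrow> y \<in> topspace X \<Longrightarrow>
      q \<beta> x = q \<beta> y \<Longrightarrow> q \<alpha> x = q \<alpha> y"
    and separated: "\<And>x y. x \<in> topspace X \<Longrightarrow> y \<in> topspace X \<Longrightarrow> x \<noteq> y \<Longrightarrow>
      \<exists>\<alpha>\<in>Field r. q \<alpha> x \<noteq> q \<alpha> y"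
  shows "\<exists>\<pi>. inverse_spectrum r Z \<pi> \<and>
      (\<forall>\<alpha> \<beta>. (\<alpha>, \<beta>) \<in> r \<longrightarrow> monotone_map (Z \<beta>) (Z \<alpha>) (\<pi> \<alpha> \<beta>)) \<and>
      X homeomorphic_space inverse_limit r Z \<pi>"
proof -
  define \<pi> where "\<pi> \<alpha> \<beta> z = q \<alpha> (SOME x. x \<in> topspace X \<and> q \<beta> x = z)" for \<alpha> \<beta> z
  have fld: "\<alpha> \<in> Field r \<and> \<beta> \<in> Field r" if "(\<alpha>, \<beta>) \<in> r" for \<alpha> \<beta>
    using that unfolding Field_def by auto
  have refl: "(\<alpha>, \<alpha>) \<in> r" if "\<alpha> \<in> Field r" for \<alpha>
    using r(1) that wo_rel.REFL[of r] unfolding wo_rel_def refl_on_def by blast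
  have tr: "(\<alpha>, \<gamma>) \<in> r" if "(\<alpha>, \<beta>) \<in> r" "(\<beta>, \<gamma>) \<in> r" for \<alpha> \<beta> \<gamma>
    using r(1) that wo_rel.TRANS[of r] unfolding wo_rel_def by (meson transD)
  have total: "(\<alpha>, \<beta>) \<in> r \<or> (\<beta>, \<alpha>) \<in> r" if "\<alpha> \<in> Field r" "\<beta> \<in> Field r" for \<alpha> \<beta>
    using r(1) that wo_rel.TOTALS[of r] unfolding wo_rel_def by blast
  have onto: "topspace (Z \<alpha>) = q \<alpha> ` topspace X" if "\<alpha> \<in> Field r" for \<alpha>
    using quotient_imp_surjective_map[OF q[OF that]] by simp
  have cont: "continuous_map X (Z \<alpha>) (q \<alpha>)" if "\<alpha> \<in> Field r" for \<alpha>
    using quotient_imp_continuous_map[OF q[OF that]] .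
  have \<pi>q: "\<pi> \<alpha> \<beta> (q \<beta> x) = q \<alpha> x" if "(\<alpha>, \<beta>) \<in> r" "x \<in> topspace X" for \<alpha> \<beta> x
  proof -
    let ?y = "SOME y. y \<in> topspace X \<and> q \<beta> y = q \<beta> x"
    have "?y \<in> topspace X \<and> q \<beta> ?y = q \<beta> x"
      by (rule someI_ex) (use that in blast)
    then show ?thesis
      unfolding \<pi>_def using finer[OF that(1)] that(2) by blast
  qed
  have \<pi>cont: "continuous_map (Z \<beta>) (Z \<alpha>) (\<pi> \<alpha> \<beta>)" if "(\<alpha>, \<beta>) \<in> r" for \<alpha> \<beta>
  proof (rule continuous_compose_quotient_map[OF q])
    show "\<beta> \<in> Field r" using fld that by blast
    show "continuous_map X (Z \<alpha>) (\<pi> \<alpha> \<beta> \<circ> q \<beta>)"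
      using cont[of \<alpha>] fld[OF that] \<pi>q[OF that] by (auto intro: continuous_map_eq)
  qed
  have spectrum: "inverse_spectrum r Z \<pi>"
    unfolding inverse_spectrum_def
  proof (intro conjI allI impI ballI)
    show "continuous_map (Z \<beta>) (Z \<alpha>) (\<pi> \<alpha> \<beta>)" if "(\<alpha>, \<beta>) \<in> r" for \<alpha> \<beta>
      using \<pi>cont that .
    show "\<pi> \<alpha> \<alpha> z = z" if "\<alpha> \<in> Field r" "z \<in> topspace (Z \<alpha>)" for \<alpha> z
      using that onto[OF that(1)] \<pi>q[OF refl[OF that(1)]] by auto
    show "\<pi> \<alpha> \<beta> (\<pi> \<beta> \<gamma> z) = \<pi> \<alpha> \<gamma> z"
      if "(\<alpha>, \<beta>) \<in> r \<and> (\<beta>, \<gamma>) \<in> r" "z \<in> topspace (Z \<gamma>)" for \<alpha> \<beta> \<gamma> z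
    proof -
      have ab: "(\<alpha>, \<beta>) \<in> r" and bc: "(\<beta>, \<gamma>) \<in> r" using that by auto
      have "z \<in> q \<gamma> ` topspace X"
        using onto[of \<gamma>] fld[OF bc] that(2) by simp
      then obtain x where "x \<in> topspace X" "z = q \<gamma> x" by blast
      then show ?thesis
        by (simp add: \<pi>q[OF ab] \<pi>q[OF bc] \<pi>q[OF tr[OF ab bc]])
    qed
  qed
  have mono: "monotone_map (Z \<beta>) (Z \<alpha>) (\<pi> \<alpha> \<beta>)" if ab: "(\<alpha>, \<beta>) \<in> r" for \<alpha> \<beta>
    unfolding monotone_map_def
  proof (intro conjI ballI)
    have F: "\<alpha> \<in> Field r" "\<beta> \<in> Field r" using fld[OF ab] by auto
    show "\<pi> \<alpha> \<beta> ` topspace (Z \<beta>) \<subseteq> topspace (Z \<alpha>)"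
      using continuous_map_image_subset_topspace[OF \<pi>cont[OF ab]] .
    fix z assume z: "z \<in> topspace (Z \<alpha>)"
    have "{y \<in> topspace (Z \<beta>). \<pi> \<alpha> \<beta> y = z} = q \<beta> ` {x \<in> topspace X. q \<alpha> x = z}"
      unfolding onto[OF F(2)] using \<pi>q[OF ab] by auto
    then show "connectedin (Z \<beta>) {y \<in> topspace (Z \<beta>). \<pi> \<alpha> \<beta> y = z}"
      using connectedin_continuous_map_image[OF cont[OF F(2)] fibres[OF F(1) z]] by simp
  qed
  define h where "h x = restrict (\<lambda>\<alpha>. q \<alpha> x) (Field r)" for x
  let ?L = "inverse_limit r Z \<pi>"
  have hL: "h ` topspace X \<subseteq> {z. \<forall>\<alpha> \<beta>. (\<alpha>, \<beta>) \<in> r \<longrightarrow> \<pi> \<alpha> \<beta> (z \<beta>) = z \<alpha>}"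
  proof (clarsimp)
    fix x \<alpha> \<beta> assume x: "x \<in> topspace X" and ab: "(\<alpha>, \<beta>) \<in> r"
    then show "\<pi> \<alpha> \<beta> (h x \<beta>) = h x \<alpha>"
      using fld[OF ab] \<pi>q[OF ab x] unfolding h_def by simp
  qed
  have "continuous_map X (product_topology Z (Field r)) h"
    unfolding continuous_map_componentwise
  proof (intro conjI ballI)
    show "h ` topspace X \<subseteq> extensional (Field r)" unfolding h_def by auto
    show "continuous_map X (Z \<alpha>) (\<lambda>x. h x \<alpha>)" if "\<alpha> \<in> Field r" for \<alpha>
      using cont[OF that] that unfolding h_def by simp
  qed
  then have hcont: "continuous_map X ?L h"
    unfolding inverse_limit_def using hL by (simp add: continuous_map_in_subtopology image_subset_iff_funcset)
  have haus: "Hausdorff_space ?L"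
    unfolding inverse_limit_def
    by (intro Hausdorff_space_subtopology) (use Z in \<open>auto simp: Hausdorff_space_product_topology\<close>)
  have inj: "inj_on h (topspace X)"
  proof (rule inj_onI, rule ccontr)
    fix x y assume xy: "x \<in> topspace X" "y \<in> topspace X" "h x = h y" "x \<noteq> y"
    then obtain \<alpha> where "\<alpha> \<in> Field r" "q \<alpha> x \<noteq> q \<alpha> y" using separated[OF xy(1,2,4)] by blast
    then show False using fun_cong[OF xy(3), of \<alpha>] unfolding h_def by simp
  qed
  have surj: "h ` topspace X = topspace ?L"
  proof
    show "h ` topspace X \<subseteq> topspace ?L"
      using continuous_map_image_subset_topspace[OF hcont] .
    show "topspace ?L \<subseteq> h ` topspace X"
    proof
      fix z assume "z \<in> topspace ?L"
      then have z: "z \<in> (\<Pi>\<^sub>E \<alpha>\<in>Field r. topspace (Z \<alpha>))"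
        and z\<pi>: "\<And>\<alpha> \<beta>. (\<alpha>, \<beta>) \<in> r \<Longrightarrow> \<pi> \<alpha> \<beta> (z \<beta>) = z \<alpha>"
        unfolding inverse_limit_def by auto
      define F where "F \<alpha> = {x \<in> topspace X. q \<alpha> x = z \<alpha>}" for \<alpha>
      have Fcl: "closedin X (F \<alpha>)" if "\<alpha> \<in> Field r" for \<alpha>
      proof -
        have "closedin (Z \<alpha>) {z \<alpha>}"
          using Z[OF that] z that by (intro closedin_Hausdorff_singleton) auto
        then show ?thesis
          using closedin_continuous_map_preimage[OF cont[OF that], of "{z \<alpha>}"] unfolding F_def by simp
      qed
      have Fne: "F \<alpha> \<noteq> {}" if "\<alpha> \<in> Field r" for \<alpha>
        using PiE_mem[OF z that] onto[OF that] unfolding F_def by auto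
      have Fmono: "F \<beta> \<subseteq> F \<alpha>" if "(\<alpha>, \<beta>) \<in> r" for \<alpha> \<beta>
      proof
        fix x assume "x \<in> F \<beta>"
        then have "x \<in> topspace X" "q \<beta> x = z \<beta>" unfolding F_def by auto
        then show "x \<in> F \<alpha>"
          using \<pi>q[OF that, of x] z\<pi>[OF that] unfolding F_def by simp
      qed
      have fin: "A \<noteq> {} \<longrightarrow> A \<subseteq> Field r \<longrightarrow> (\<exists>\<beta>\<in>Field r. \<forall>\<alpha>\<in>A. (\<alpha>, \<beta>) \<in> r)" if "finite A" for A
        using that
      proof (induction A rule: finite_induct)
        case (insert a A)
        show ?case
        proof (intro impI)
          assume sub: "insert a A \<subseteq> Field r"
          show "\<exists>\<beta>\<in>Field r. \<forall>\<alpha>\<in>insert a A. (\<alpha>, \<beta>) \<in> r"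
          proof (cases "A = {}")
            case True
            then show ?thesis using refl sub by auto
          next
            case False
            then obtain \<beta> where b: "\<beta> \<in> Field r" "\<forall>\<alpha>\<in>A. (\<alpha>, \<beta>) \<in> r"
              using insert sub by blast
            show ?thesis
            proof (cases "(a, \<beta>) \<in> r")
              case True
              then show ?thesis using b by blast
            next
              case False
              have a: "a \<in> Field r" using sub by simp
              then have ba: "(\<beta>, a) \<in> r" using total[OF a b(1)] False by simp
              show ?thesis
                by (rule bexI[OF _ a]) (use b tr[OF _ ba] refl[OF a] in auto)
            qed
          qed
        qed
      qed simp
      have "\<Inter>(F ` Field r) \<noteq> {}"
      proof -
        have "\<Inter>\<F> \<noteq> {}" if \<F>: "finite \<F>" "\<F> \<subseteq> F ` Field r" for \<F>
        proof (cases "\<F> = {}")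
          case False
          obtain A where A: "A \<subseteq> Field r" "finite A" "\<F> = F ` A"
            using finite_subset_image[OF \<F>] by blast
          then obtain \<beta> where b: "\<beta> \<in> Field r" "\<forall>\<alpha>\<in>A. (\<alpha>, \<beta>) \<in> r"
            using fin False by blast
          then have "F \<beta> \<subseteq> \<Inter>\<F>" using Fmono A by blast
          then show ?thesis using Fne[OF b(1)] by blast
        qed simp
        moreover have "\<forall>C\<in>F ` Field r. closedin X C" using Fcl by blast
        ultimately show ?thesis
          using X unfolding compact_space_fip by presburger
      qed
      then obtain x where x: "\<And>\<alpha>. \<alpha> \<in> Field r \<Longrightarrow> x \<in> F \<alpha>" by blast
      have "Field r \<noteq> {}" using r(2) unfolding Field_def by auto
      then have "x \<in> topspace X" using x unfolding F_def by blast
      moreover have "h x = z"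
      proof
        fix \<alpha> show "h x \<alpha> = z \<alpha>"
          using x[of \<alpha>] PiE_arb[OF z, of \<alpha>] unfolding h_def F_def
          by (cases "\<alpha> \<in> Field r") simp_all
      qed
      ultimately show "z \<in> h ` topspace X" by (metis image_eqI)
    qed
  qed
  have "homeomorphic_map X ?L h"
    using continuous_imp_homeomorphic_map[OF hcont X haus surj inj] .
  then have "X homeomorphic_space ?L"
    by (rule homeomorphic_map_imp_homeomorphic_space)
  with spectrum mono show ?thesis by (intro exI[of _ \<pi>]) simp
qed

section \<open>Decompositions given by real functions\<close>

text \<open>
  The diagonal map of \<open>\<Phi>\<close> into \<open>\<real>\<^sup>\<Phi>\<close>.
\<close>

definition evaluation :: "('k \<Rightarrow> real) set \<Rightarrow> 'k \<Rightarrow> ('k \<Rightarrow> real) \<Rightarrow> real" where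
  "evaluation \<Phi> x = restrict (\<lambda>\<phi>. \<phi> x) \<Phi>"

lemma evaluation_eq_iff: "evaluation \<Phi> x = evaluation \<Phi> y \<longleftrightarrow> (\<forall>\<phi>\<in>\<Phi>. \<phi> x = \<phi> y)"
  unfolding evaluation_def restrict_def fun_eq_iff by auto

text \<open>
  Preimages of open rays with rational endpoints suffice, and there are at most \<open>|\<Phi>| \<cdot> \<aleph>\<^sub>0\<close> of them.
\<close>

lemma separating_opens_evaluation:
  assumes cont: "\<And>\<phi>. \<phi> \<in> \<Phi> \<Longrightarrow> continuous_map K euclideanreal \<phi>"
    and \<Phi>: "|\<Phi>| \<le>o \<kappa>" and \<kappa>: "Cinfinite \<kappa>"
  obtains \<V> where "separating_opens K (evaluation \<Phi>) \<V>" "|\<V>| \<le>o \<kappa>"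
proof
  let ?L = "\<lambda>(\<phi>, a). {x \<in> topspace K. \<phi> x < a}" and ?R = "\<lambda>(\<phi>, a). {x \<in> topspace K. a < \<phi> x}"
  let ?\<V> = "?L ` (\<Phi> \<times> \<rat>) \<union> ?R ` (\<Phi> \<times> \<rat>)"
  obtain g :: "real \<Rightarrow> nat" where "inj_on g \<rat>"
    using countable_rat unfolding countable_def by blast
  then have "|\<rat> :: real set| \<le>o |UNIV :: nat set|"
    using card_of_ordLeq[of "\<rat> :: real set" "UNIV :: nat set"] by blast
  then have "|\<rat> :: real set| \<le>o natLeq"
    using card_of_nat ordLeq_ordIso_trans by blast
  then have "|\<rat> :: real set| \<le>o \<kappa>"
    using natLeq_ordLeq_cinfinite[OF \<kappa>] ordLeq_transitive by blast
  then show "|?\<V>| \<le>o \<kappa>"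
    by (intro Un_Cinfinite_bound image_bound Times_Cinfinite_bound \<Phi> \<kappa>)
  show "separating_opens K (evaluation \<Phi>) ?\<V>"
    unfolding separating_opens_def
  proof (intro conjI ballI impI)
    fix V assume "V \<in> ?\<V>"
    then obtain \<phi> a where \<phi>: "\<phi> \<in> \<Phi>"
      and V: "V = {x \<in> topspace K. \<phi> x \<in> {..<a}} \<or> V = {x \<in> topspace K. \<phi> x \<in> {a<..}}"
      by auto
    show "openin K V"
      using V openin_continuous_map_preimage[OF cont[OF \<phi>], of "{..<a}"]
        openin_continuous_map_preimage[OF cont[OF \<phi>], of "{a<..}"] by auto
    show "y \<in> V" if "x \<in> V" "y \<in> topspace K" "evaluation \<Phi> y = evaluation \<Phi> x" for x y
      using V that \<phi> unfolding evaluation_eq_iff by auto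
  next
    have *: "\<exists>U\<in>?\<V>. \<exists>V\<in>?\<V>. x \<in> U \<and> y \<in> V \<and> disjnt U V"
      if xy: "x \<in> topspace K" "y \<in> topspace K" "\<phi> \<in> \<Phi>" "\<phi> x < \<phi> y" for x y \<phi>
    proof -
      obtain a where a: "a \<in> \<rat>" "\<phi> x < a" "a < \<phi> y"
        using Rats_dense_in_real[OF xy(4)] by blast
      show ?thesis
      proof (intro bexI conjI)
        show "x \<in> ?L (\<phi>, a)" "y \<in> ?R (\<phi>, a)" using a xy by auto
        show "?L (\<phi>, a) \<in> ?\<V>" "?R (\<phi>, a) \<in> ?\<V>" using a xy by blast+
        show "disjnt (?L (\<phi>, a)) (?R (\<phi>, a))" by (auto simp: disjnt_iff)
      qed
    qed
    fix x y assume xy: "x \<in> topspace K" "y \<in> topspace K" "evaluation \<Phi> x \<noteq> evaluation \<Phi> y"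
    then obtain \<phi> where "\<phi> \<in> \<Phi>" "\<phi> x < \<phi> y \<or> \<phi> y < \<phi> x"
      unfolding evaluation_eq_iff by (meson linorder_neqE)
    then show "\<exists>U\<in>?\<V>. \<exists>V\<in>?\<V>. x \<in> U \<and> y \<in> V \<and> disjnt U V"
      using *[of x y \<phi>] *[of y x \<phi>] xy by (meson disjnt_sym)
  qed
qed

lemma fibre_component_antimono:
  assumes "\<Phi> \<subseteq> \<Psi>"
  shows "fibre_component K (evaluation \<Psi>) x \<subseteq> fibre_component K (evaluation \<Phi>) x"
proof (cases "x \<in> topspace K")
  case True
  show ?thesis
  proof (rule fibre_component_maximal)
    show "connectedin K (fibre_component K (evaluation \<Psi>) x)"
      by (rule connectedin_fibre_component)
    show "x \<in> fibre_component K (evaluation \<Psi>) x"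
      by (rule fibre_component_refl[OF True])
    fix y assume "y \<in> fibre_component K (evaluation \<Psi>) x"
    then have "evaluation \<Psi> y = evaluation \<Psi> x"
      using fibre_component_subset by fast
    then show "evaluation \<Phi> y = evaluation \<Phi> x"
      using assms unfolding evaluation_eq_iff by blast
  qed
next
  case False
  then have "fibre_component K (evaluation \<Psi>) x = {}"
    unfolding fibre_component_def connected_component_of_eq_empty by simp
  then show ?thesis by simp
qed

lemma Urysohn_0_1:
  assumes "compact_space K" "Hausdorff_space K" "closedin K A" "closedin K B" "disjnt A B"
  obtains f where "continuous_map K euclideanreal f" "\<forall>x\<in>A. f x = (0::real)" "\<forall>x\<in>B. f x = 1"
proof -
  have "normal_space K"
    using assms compact_Hausdorff_or_regular_imp_normal_space by blast
  then obtain f where "continuous_map K euclideanreal f" "f ` A \<subseteq> {0}" "f ` B \<subseteq> {1}"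
    by (rule Urysohn_lemma_alt[OF _ assms(3-5)])
  then show ?thesis using that by blast
qed

text \<open>
  The functions vanish on \<open>E\<close> and equal \<open>1\<close> on the members of a maximal disjoint family of
  nondegenerate subcontinua missing \<open>E\<close>. A set \<open>F\<close> that meets \<open>E\<close> and on which they are constant avoids
  the whole family. If \<open>F\<close> were a continuum not contained in \<open>E\<close>, it would have a nondegenerate
  subcontinuum off \<open>E\<close>, which could be added to the family.
\<close>

lemma ex_shielding_functions:
  assumes K: "continuum_space K" and E: "closedin K E"
  obtains \<Phi> where "|\<Phi>| \<le>o continuum_Sln K" "\<forall>\<phi>\<in>\<Phi>. continuous_map K euclideanreal \<phi>"
    "\<forall>F. compactin K F \<and> connectedin K F \<and> F \<inter> E \<noteq> {} \<and>
      (\<forall>\<phi>\<in>\<Phi>. \<forall>x\<in>F. \<forall>y\<in>F. \<phi> x = \<phi> y) \<longrightarrow> F \<subseteq> E"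
proof -
  have K': "compact_space K" "Hausdorff_space K"
    using K unfolding continuum_space_def by auto
  define \<A> where "\<A> = {\<C>. disjoint \<C> \<and> (\<forall>C\<in>\<C>. nondegenerate_subcontinuum K C \<and> disjnt C E)}"
  have "\<exists>\<C>\<in>\<A>. \<forall>\<D>\<in>\<A>. \<C> \<subseteq> \<D> \<longrightarrow> \<D> = \<C>"
  proof (rule subset_Zorn')
    fix \<T> assume \<T>: "subset.chain \<A> \<T>"
    have "disjoint (\<Union>\<T>)"
      unfolding pairwise_def
    proof (intro ballI impI)
      fix C D assume CD: "C \<in> \<Union>\<T>" "D \<in> \<Union>\<T>" "C \<noteq> D"
      then obtain S T where ST: "S \<in> \<T>" "T \<in> \<T>" "C \<in> S" "D \<in> T" by blast
      then have "S \<subseteq> T \<or> T \<subseteq> S" "disjoint S" "disjoint T"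
        using \<T> unfolding subset_chain_def \<A>_def by blast+
      then show "disjnt C D"
        using ST CD(3) pairwiseD by (metis subsetD)
    qed
    moreover have "\<T> \<subseteq> \<A>"
      using \<T> unfolding subset_chain_def by simp
    ultimately show "\<Union>\<T> \<in> \<A>"
      unfolding \<A>_def by auto
  qed
  then obtain \<C> where "\<C> \<in> \<A>" and max: "\<forall>\<D>\<in>\<A>. \<C> \<subseteq> \<D> \<longrightarrow> \<D> = \<C>"
    by blast
  then have \<C>: "disjoint \<C>" "\<And>C. C \<in> \<C> \<Longrightarrow> nondegenerate_subcontinuum K C"
      "\<And>C. C \<in> \<C> \<Longrightarrow> disjnt C E"
    unfolding \<A>_def by simp_all
  have "\<forall>C\<in>\<C>. \<exists>f. continuous_map K euclideanreal f \<and> (\<forall>x\<in>E. f x = 0) \<and> (\<forall>x\<in>C. f x = 1)"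
  proof
    fix C assume C: "C \<in> \<C>"
    then have "compactin K C"
      using \<C>(2) by (simp add: nondegenerate_subcontinuum_def continuum_space_def compactin_subspace)
    then have "closedin K C"
      using K' compactin_imp_closedin by blast
    moreover have "disjnt E C"
      using \<C>(3)[OF C] disjnt_sym by blast
    ultimately obtain f where "continuous_map K euclideanreal f" "\<forall>x\<in>E. f x = 0" "\<forall>x\<in>C. f x = 1"
      by (rule Urysohn_0_1[OF K' E])
    then show "\<exists>f. continuous_map K euclideanreal f \<and> (\<forall>x\<in>E. f x = 0) \<and> (\<forall>x\<in>C. f x = 1)"
      by blast
  qed
  then obtain f where f: "\<And>C. C \<in> \<C> \<Longrightarrow> continuous_map K euclideanreal (f C)"
    "\<And>C x. C \<in> \<C> \<Longrightarrow> x \<in> E \<Longrightarrow> f C x = 0" "\<And>C x. C \<in> \<C> \<Longrightarrow> x \<in> C \<Longrightarrow> f C x = 1"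
    by metis
  show ?thesis
  proof
    show "|f ` \<C>| \<le>o continuum_Sln K"
      by (intro image_bound continuum_Sln(3)) (use \<C> in auto)
    show "\<forall>\<phi>\<in>f ` \<C>. continuous_map K euclideanreal \<phi>"
      using f(1) by blast
    have *: "F \<subseteq> E" if F: "compactin K F" "connectedin K F" "F \<inter> E \<noteq> {}"
      and const: "\<forall>\<phi>\<in>f ` \<C>. \<forall>x\<in>F. \<forall>y\<in>F. \<phi> x = \<phi> y" for F
    proof (rule ccontr)
      assume "\<not> F \<subseteq> E"
      then obtain D where D: "nondegenerate_subcontinuum K D" "D \<subseteq> F - E"
        using subcontinuum_avoiding[OF K'(2) F(1,2) E F(3)] by blast
      obtain z where z: "z \<in> F" "z \<in> E" using F(3) by blast
      have FC: "disjnt F C" if C: "C \<in> \<C>" for C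
        unfolding disjnt_iff
      proof (intro allI notI)
        fix x assume x: "x \<in> F \<and> x \<in> C"
        then have "f C x = f C z" using const C z by blast
        then show False using f(2)[OF C z(2)] f(3)[OF C, of x] x by simp
      qed
      have "disjoint (insert D \<C>)"
        using \<C>(1) FC D(2) unfolding pairwise_insert disjnt_iff by blast
      then have "insert D \<C> \<in> \<A>"
        using \<C> D unfolding \<A>_def by (auto simp: disjnt_iff)
      then have "D \<in> \<C>" using max by blast
      then have "disjnt F D" using FC by blast
      then have "D = {}" using D(2) unfolding disjnt_iff by blast
      then show False using D(1) unfolding nondegenerate_subcontinuum_def by blast
    qed
    show "\<forall>F. compactin K F \<and> connectedin K F \<and> F \<inter> E \<noteq> {} \<and>
      (\<forall>\<phi>\<in>f ` \<C>. \<forall>x\<in>F. \<forall>y\<in>F. \<phi> x = \<phi> y) \<longrightarrow> F \<subseteq> E"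
      by (intro allI impI; elim conjE) (rule *)
  qed
qed

section \<open>The tower of decompositions\<close>

lemma ex_well_order_recursive_unions:
  fixes r :: "'i rel" and B :: "'b set \<Rightarrow> 'b set"
  assumes "Well_order r"
  obtains \<Phi> where "\<forall>\<alpha>. \<Phi> \<alpha> = \<Phi>\<^sub>0 \<union> (\<Union>\<beta>\<in>underS r \<alpha>. \<Phi> \<beta> \<union> B (\<Phi> \<beta>))"
proof -
  have wo: "wo_rel r" using assms unfolding wo_rel_def .
  let ?H = "\<lambda>f \<alpha>. \<Phi>\<^sub>0 \<union> (\<Union>\<beta>\<in>underS r \<alpha>. f \<beta> \<union> B (f \<beta>))"
  have "wo_rel.adm_wo r ?H"
    unfolding wo_rel.adm_wo_def[OF wo] by auto
  then have "wo_rel.worec r ?H = ?H (wo_rel.worec r ?H)"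
    by (rule wo_rel.worec_fixpoint[OF wo])
  then show ?thesis
    using that[of "wo_rel.worec r ?H"] by (metis (no_types, lifting))
qed

text \<open>
  Each stage contains the shielding functions of \<open>E\<close>, all earlier stages, and for every
  nondegenerate piece of an earlier stage a function nonconstant on it. A stage has at most
  \<open>continuum_Sln K\<close> nondegenerate pieces because they are disjoint subcontinua, so the stages stay
  small. If the tower left two points together, each of its stages would contribute a
  subcontinuum disjoint from those of the other stages, and the tower is too long for that.
\<close>

lemma ex_tower_of_decompositions:
  fixes K :: "'k topology" and r :: "'i rel"
  assumes K: "continuum_space K" and E: "closedin K E" and r: "Well_order r"
    and short: "\<And>\<alpha>. \<alpha> \<in> Field r \<Longrightarrow> |underS r \<alpha>| \<le>o continuum_Sln K"
    and long: "\<not> |Field r| \<le>o continuum_Sln K"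
  obtains \<Phi> :: "'i \<Rightarrow> ('k \<Rightarrow> real) set" where
    "\<forall>\<alpha>\<in>Field r. \<exists>\<W>. separating_opens K (fibre_component K (evaluation (\<Phi> \<alpha>))) \<W> \<and>
      |\<W>| \<le>o continuum_Sln K"
    "\<forall>\<alpha> \<beta>. (\<alpha>, \<beta>) \<in> r \<longrightarrow> \<Phi> \<alpha> \<subseteq> \<Phi> \<beta>"
    "\<forall>\<alpha>\<in>Field r. \<forall>x\<in>E. fibre_component K (evaluation (\<Phi> \<alpha>)) x \<subseteq> E"
    "\<forall>x\<in>topspace K. \<forall>y\<in>topspace K. x \<noteq> y \<longrightarrow>
      (\<exists>\<alpha>\<in>Field r. fibre_component K (evaluation (\<Phi> \<alpha>)) x \<noteq> fibre_component K (evaluation (\<Phi> \<alpha>)) y)"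
proof -
  let ?\<kappa> = "continuum_Sln K" and ?fc = "\<lambda>\<Psi>. fibre_component K (evaluation \<Psi>)"
  have wo: "wo_rel r" using r unfolding wo_rel_def .
  have K': "compact_space K" "connected_space K" "Hausdorff_space K"
    using K unfolding continuum_space_def by auto
  obtain \<Phi>\<^sub>0 where \<Phi>\<^sub>0: "|\<Phi>\<^sub>0| \<le>o ?\<kappa>" "\<forall>\<phi>\<in>\<Phi>\<^sub>0. continuous_map K euclideanreal \<phi>"
    and shield: "\<forall>F. compactin K F \<and> connectedin K F \<and> F \<inter> E \<noteq> {} \<and>
      (\<forall>\<phi>\<in>\<Phi>\<^sub>0. \<forall>x\<in>F. \<forall>y\<in>F. \<phi> x = \<phi> y) \<longrightarrow> F \<subseteq> E"
    by (rule ex_shielding_functions[OF K E])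
  have "\<exists>f. nondegenerate_subcontinuum K C \<longrightarrow>
      continuous_map K euclideanreal f \<and> (\<exists>x\<in>C. \<exists>y\<in>C. f x \<noteq> f y)" for C
  proof (cases "nondegenerate_subcontinuum K C")
    case True
    then obtain x y where xy: "x \<in> C" "y \<in> C" "x \<noteq> y" "x \<in> topspace K" "y \<in> topspace K"
      unfolding nondegenerate_subcontinuum_def by blast
    then have "closedin K {x}" "closedin K {y}" "disjnt {x} {y}"
      using K' by (simp_all add: closedin_Hausdorff_singleton)
    then obtain f where "continuous_map K euclideanreal f" "\<forall>z\<in>{x}. f z = 0" "\<forall>z\<in>{y}. f z = 1"
      by (rule Urysohn_0_1[OF K'(1,3)])
    then have "continuous_map K euclideanreal f \<and> (\<exists>x\<in>C. \<exists>y\<in>C. f x \<noteq> f y)"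
      using xy by (intro conjI bexI[of _ x] bexI[of _ y]) simp_all
    then show ?thesis by blast
  qed simp
  then obtain b where b: "\<And>C. nondegenerate_subcontinuum K C \<Longrightarrow> continuous_map K euclideanreal (b C)"
    "\<And>C. nondegenerate_subcontinuum K C \<Longrightarrow> \<exists>x\<in>C. \<exists>y\<in>C. b C x \<noteq> b C y"
    by metis
  (* b picks a function breaking a nondegenerate subcontinuum; N collects the pieces to break. *)
  define N where "N \<Psi> = {C \<in> range (?fc \<Psi>). nondegenerate_subcontinuum K C}" for \<Psi>
  have N: "|b ` N \<Psi>| \<le>o ?\<kappa>" for \<Psi>
  proof (intro image_bound continuum_Sln(3))
    show "disjoint (N \<Psi>)"
      using disjoint_fibre_components pairwise_subset unfolding N_def by (metis (no_types, lifting) mem_Collect_eq subsetI)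
    show "nondegenerate_subcontinuum K C" if "C \<in> N \<Psi>" for C
      using that unfolding N_def by simp
  qed
  obtain \<Phi> where "\<forall>\<alpha>. \<Phi> \<alpha> = \<Phi>\<^sub>0 \<union> (\<Union>\<beta>\<in>underS r \<alpha>. \<Phi> \<beta> \<union> b ` N (\<Phi> \<beta>))"
    by (rule ex_well_order_recursive_unions[OF r, of \<Phi>\<^sub>0 "\<lambda>\<Psi>. b ` N \<Psi>"])
  then have \<Phi>: "\<Phi> \<alpha> = \<Phi>\<^sub>0 \<union> (\<Union>\<beta>\<in>underS r \<alpha>. \<Phi> \<beta> \<union> b ` N (\<Phi> \<beta>))" for \<alpha>
    by (rule spec)
  have cont: "\<forall>\<phi>\<in>\<Phi> \<alpha>. continuous_map K euclideanreal \<phi>" for \<alpha>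
  proof (induction \<alpha> rule: wo_rel.well_order_induct[OF wo])
    case (1 \<alpha>)
    show ?case
    proof
      fix \<phi> assume "\<phi> \<in> \<Phi> \<alpha>"
      then consider "\<phi> \<in> \<Phi>\<^sub>0" | \<beta> where "\<beta> \<in> underS r \<alpha>" "\<phi> \<in> \<Phi> \<beta>"
        | \<beta> C where "C \<in> N (\<Phi> \<beta>)" "\<phi> = b C"
        using \<Phi>[of \<alpha>] by blast
      then show "continuous_map K euclideanreal \<phi>"
      proof cases
        case 1 then show ?thesis using \<Phi>\<^sub>0(2) by simp
      next
        case 2 then show ?thesis using "1" unfolding underS_def by simp
      next
        case 3 then show ?thesis using b(1) unfolding N_def by simp
      qed
    qed
  qed
  have small: "\<alpha> \<in> Field r \<longrightarrow> |\<Phi> \<alpha>| \<le>o ?\<kappa>" for \<alpha>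
  proof (induction \<alpha> rule: wo_rel.well_order_induct[OF wo])
    case (1 \<alpha>)
    show ?case
    proof
      assume \<alpha>: "\<alpha> \<in> Field r"
      have "|\<Phi> \<beta>| \<le>o ?\<kappa>" if "\<beta> \<in> underS r \<alpha>" for \<beta>
      proof -
        have "(\<beta>, \<alpha>) \<in> r" "\<beta> \<noteq> \<alpha>" using that unfolding underS_def by auto
        then show ?thesis using 1 FieldI1[of \<beta> \<alpha> r] by blast
      qed
      then show "|\<Phi> \<alpha>| \<le>o ?\<kappa>"
        unfolding \<Phi>[of \<alpha>]
        by (intro Un_Cinfinite_bound UNION_Cinfinite_bound ballI \<Phi>\<^sub>0(1) N short \<alpha> Cinfinite_continuum_Sln)
    qed
  qed
  have ev: "\<exists>\<V>. separating_opens K (evaluation (\<Phi> \<alpha>)) \<V> \<and> |\<V>| \<le>o ?\<kappa>" if "\<alpha> \<in> Field r" for \<alpha>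
  proof -
    have c: "continuous_map K euclideanreal \<phi>" if "\<phi> \<in> \<Phi> \<alpha>" for \<phi>
      using cont that by blast
    have s: "|\<Phi> \<alpha>| \<le>o ?\<kappa>" using small that by blast
    obtain \<V> where "separating_opens K (evaluation (\<Phi> \<alpha>)) \<V>" "|\<V>| \<le>o ?\<kappa>"
      by (rule separating_opens_evaluation[OF c s Cinfinite_continuum_Sln])
    then show ?thesis by blast
  qed
  have mono: "\<Phi> \<alpha> \<subseteq> \<Phi> \<beta>" if "(\<alpha>, \<beta>) \<in> r" for \<alpha> \<beta>
  proof (cases "\<alpha> = \<beta>")
    case False
    then have "\<alpha> \<in> underS r \<beta>" using that unfolding underS_def by simp
    then show ?thesis unfolding \<Phi>[of \<beta>] by blast
  qed simp
  have cpt: "compactin K (?fc (\<Phi> \<alpha>) x)" if \<alpha>: "\<alpha> \<in> Field r" for \<alpha> x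
  proof -
    obtain \<V> where "separating_opens K (evaluation (\<Phi> \<alpha>)) \<V>"
      using ev[OF \<alpha>] by blast
    then show ?thesis
      by (intro closedin_compact_space[OF K'(1)] closedin_fibre_component)
  qed
  have const: "\<phi> y = \<phi> x" if "y \<in> ?fc \<Psi> x" "\<phi> \<in> \<Psi>" for \<phi> \<Psi> x y
  proof -
    have "evaluation \<Psi> y = evaluation \<Psi> x"
      using fibre_component_subset[of K "evaluation \<Psi>" x] that(1) by auto
    then show ?thesis using that(2) unfolding evaluation_eq_iff by simp
  qed
  show ?thesis
  proof (rule that; intro ballI allI impI)
    show "\<Phi> \<alpha> \<subseteq> \<Phi> \<beta>" if "(\<alpha>, \<beta>) \<in> r" for \<alpha> \<beta>
      using mono that .
    show "\<exists>\<W>. separating_opens K (?fc (\<Phi> \<alpha>)) \<W> \<and> |\<W>| \<le>o ?\<kappa>" if \<alpha>: "\<alpha> \<in> Field r" for \<alpha>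
    proof -
      obtain \<V> where "separating_opens K (evaluation (\<Phi> \<alpha>)) \<V>" "|\<V>| \<le>o ?\<kappa>"
        using ev[OF \<alpha>] by blast
      then obtain \<W> where "separating_opens K (?fc (\<Phi> \<alpha>)) \<W>" "|\<W>| \<le>o ?\<kappa>"
        by (rule separating_opens_fibre_component[OF K])
      then show ?thesis by blast
    qed
    show "?fc (\<Phi> \<alpha>) x \<subseteq> E" if \<alpha>: "\<alpha> \<in> Field r" and x: "x \<in> E" for \<alpha> x
    proof (rule shield[rule_format], intro conjI ballI)
      show "compactin K (?fc (\<Phi> \<alpha>) x)" "connectedin K (?fc (\<Phi> \<alpha>) x)"
        by (rule cpt[OF \<alpha>], rule connectedin_fibre_component)
      have "x \<in> topspace K" using x E closedin_subset by blast
      then show "?fc (\<Phi> \<alpha>) x \<inter> E \<noteq> {}"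
        using x fibre_component_refl by fast
      fix \<phi> y z assume "\<phi> \<in> \<Phi>\<^sub>0" and yz: "y \<in> ?fc (\<Phi> \<alpha>) x" "z \<in> ?fc (\<Phi> \<alpha>) x"
      then have \<phi>: "\<phi> \<in> \<Phi> \<alpha>" using \<Phi>[of \<alpha>] by blast
      show "\<phi> y = \<phi> z" using const[OF yz(1) \<phi>] const[OF yz(2) \<phi>] by simp
    qed
    fix x y assume x: "x \<in> topspace K" and y: "y \<in> topspace K" and "x \<noteq> y"
    show "\<exists>\<alpha>\<in>Field r. ?fc (\<Phi> \<alpha>) x \<noteq> ?fc (\<Phi> \<alpha>) y"
    proof (rule ccontr)
      assume "\<not> ?thesis"
      then have eq: "?fc (\<Phi> \<alpha>) x = ?fc (\<Phi> \<alpha>) y" if "\<alpha> \<in> Field r" for \<alpha>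
        using that by blast
      define C where "C \<alpha> = ?fc (\<Phi> \<alpha>) x" for \<alpha>
      have xC: "x \<in> C \<alpha>" for \<alpha>
        unfolding C_def by (rule fibre_component_refl[OF x])
      have nd: "nondegenerate_subcontinuum K (C \<alpha>)" if \<alpha>: "\<alpha> \<in> Field r" for \<alpha>
      proof -
        obtain \<V> where \<V>: "separating_opens K (evaluation (\<Phi> \<alpha>)) \<V>"
          using ev[OF \<alpha>] by blast
        have "y \<in> ?fc (\<Phi> \<alpha>) x"
          unfolding eq[OF \<alpha>] by (rule fibre_component_refl[OF y])
        then have "?fc (\<Phi> \<alpha>) x \<noteq> {x}" using \<open>x \<noteq> y\<close> by auto
        then show ?thesis
          unfolding C_def by (rule nondegenerate_fibre_component[OF K \<V> x])
      qed
      (* B \<alpha> contains every later piece around x, since the function b (C \<alpha>) is constant on it.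
         Hence a subcontinuum of C \<alpha> - B \<alpha> is disjoint from all later pieces. *)
      define B where "B \<alpha> = {z \<in> topspace K. b (C \<alpha>) z = b (C \<alpha>) x}" for \<alpha>
      have "\<exists>D. nondegenerate_subcontinuum K D \<and> D \<subseteq> C \<alpha> - B \<alpha>" if \<alpha>: "\<alpha> \<in> Field r" for \<alpha>
      proof -
        have 1: "closedin K (B \<alpha>)"
          using closedin_continuous_map_preimage[OF b(1)[OF nd[OF \<alpha>]], of "{b (C \<alpha>) x}"]
          unfolding B_def by simp
        have "x \<in> B \<alpha>" using x unfolding B_def by simp
        then have 2: "C \<alpha> \<inter> B \<alpha> \<noteq> {}" using xC by blast
        have 3: "\<not> C \<alpha> \<subseteq> B \<alpha>"
        proof
          assume "C \<alpha> \<subseteq> B \<alpha>"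
          then have "b (C \<alpha>) z = b (C \<alpha>) x" if "z \<in> C \<alpha>" for z
            using that unfolding B_def by blast
          then show False
            using b(2)[OF nd[OF \<alpha>]] by metis
        qed
        have 4: "compactin K (C \<alpha>)" "connectedin K (C \<alpha>)"
          unfolding C_def by (rule cpt[OF \<alpha>], rule connectedin_fibre_component)
        obtain D where "nondegenerate_subcontinuum K D" "D \<subseteq> C \<alpha> - B \<alpha>"
          by (rule subcontinuum_avoiding[OF K'(3) 4 1 2 3])
        then show ?thesis by blast
      qed
      then obtain D where D: "\<And>\<alpha>. \<alpha> \<in> Field r \<Longrightarrow> nondegenerate_subcontinuum K (D \<alpha>)"
        "\<And>\<alpha>. \<alpha> \<in> Field r \<Longrightarrow> D \<alpha> \<subseteq> C \<alpha> - B \<alpha>"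
        by metis
      have dis: "disjnt (D \<alpha>) (D \<beta>)" if \<alpha>\<beta>: "(\<alpha>, \<beta>) \<in> r" "\<alpha> \<noteq> \<beta>" for \<alpha> \<beta>
      proof -
        have F: "\<alpha> \<in> Field r" "\<beta> \<in> Field r" using \<alpha>\<beta>(1) FieldI1 FieldI2 by metis+
        have "C \<alpha> \<in> N (\<Phi> \<alpha>)"
          using nd[OF F(1)] unfolding N_def C_def by blast
        moreover have "\<alpha> \<in> underS r \<beta>" using \<alpha>\<beta> unfolding underS_def by simp
        ultimately have b\<beta>: "b (C \<alpha>) \<in> \<Phi> \<beta>"
          unfolding \<Phi>[of \<beta>] by blast
        have "C \<beta> \<subseteq> B \<alpha>"
        proof
          fix z assume z: "z \<in> C \<beta>"
          then have "z \<in> topspace K"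
            using fibre_component_subset[of K "evaluation (\<Phi> \<beta>)" x] unfolding C_def by auto
          then show "z \<in> B \<alpha>"
            using const[OF z[unfolded C_def] b\<beta>] unfolding B_def by simp
        qed
        then show ?thesis
          using D(2)[OF F(1)] D(2)[OF F(2)] unfolding disjnt_iff by blast
      qed
      have dis': "disjnt (D \<alpha>) (D \<beta>)" if "\<alpha> \<in> Field r" "\<beta> \<in> Field r" "\<alpha> \<noteq> \<beta>" for \<alpha> \<beta>
        using wo_rel.TOTALS[OF wo] dis[of \<alpha> \<beta>] dis[of \<beta> \<alpha>] that disjnt_sym by metis
      have ne: "D \<alpha> \<noteq> {}" if "\<alpha> \<in> Field r" for \<alpha>
        using D(1)[OF that] unfolding nondegenerate_subcontinuum_def by blast
      have "inj_on D (Field r)"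
      proof (rule inj_onI, rule ccontr)
        fix \<alpha> \<beta> assume ab: "\<alpha> \<in> Field r" "\<beta> \<in> Field r" "D \<alpha> = D \<beta>" "\<alpha> \<noteq> \<beta>"
        then show False using dis'[OF ab(1,2,4)] ne[OF ab(1)] unfolding disjnt_def by simp
      qed
      then have "|Field r| \<le>o |D ` Field r|"
        using card_of_ordLeq[of "Field r" "D ` Field r"] by blast
      moreover have "|D ` Field r| \<le>o ?\<kappa>"
      proof (rule continuum_Sln(3))
        show "disjoint (D ` Field r)"
          unfolding pairwise_def using dis' by (metis imageE)
      qed (use D(1) in blast)
      ultimately show False
        using long ordLeq_transitive by blast
    qed
  qed
qed

section \<open>The spectrum of a compact space\<close>

lemma separating_opens_preimage:
  assumes e: "continuous_map X K e" and \<W>: "separating_opens K c \<W>"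
    and q: "\<And>x y. x \<in> topspace X \<Longrightarrow> y \<in> topspace X \<Longrightarrow> q x = q y \<longleftrightarrow> c (e x) = c (e y)"
  shows "separating_opens X q ((\<lambda>W. {x \<in> topspace X. e x \<in> W}) ` \<W>)"
  unfolding separating_opens_def
proof (intro conjI ballI impI)
  have eK: "e x \<in> topspace K" if "x \<in> topspace X" for x
    using continuous_map_image_subset_topspace[OF e] that by blast
  {
    fix V assume "V \<in> (\<lambda>W. {x \<in> topspace X. e x \<in> W}) ` \<W>"
    then obtain W where W: "W \<in> \<W>" "V = {x \<in> topspace X. e x \<in> W}" by blast
    show "openin X V"
      unfolding W(2) by (rule openin_continuous_map_preimage[OF e separating_opensD(1)[OF \<W> W(1)]])
    fix x y assume xy: "x \<in> V" "y \<in> topspace X" "q y = q x"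
    then have "e x \<in> W" "x \<in> topspace X" using W(2) by auto
    then have "e y \<in> W"
      using separating_opensD(2)[OF \<W> W(1) _ eK[OF xy(2)], of "e x"] q[OF xy(2), of x] xy(3) by simp
    then show "y \<in> V" using W(2) xy(2) by simp
  }
  fix x y assume xy: "x \<in> topspace X" "y \<in> topspace X" "q x \<noteq> q y"
  then have "c (e x) \<noteq> c (e y)" using q by simp
  then obtain U V where UV: "U \<in> \<W>" "V \<in> \<W>" "e x \<in> U" "e y \<in> V" "disjnt U V"
    using separating_opensD(3)[OF \<W> eK[OF xy(1)] eK[OF xy(2)]] by blast
  show "\<exists>U\<in>(\<lambda>W. {x \<in> topspace X. e x \<in> W}) ` \<W>. \<exists>V\<in>(\<lambda>W. {x \<in> topspace X. e x \<in> W}) ` \<W>.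
      x \<in> U \<and> y \<in> V \<and> disjnt U V"
  proof (intro bexI conjI)
    show "x \<in> {x \<in> topspace X. e x \<in> U}" "y \<in> {x \<in> topspace X. e x \<in> V}"
      using xy UV by simp_all
    show "disjnt {x \<in> topspace X. e x \<in> U} {x \<in> topspace X. e x \<in> V}"
      using UV(5) by (auto simp: disjnt_iff)
  qed (use UV in blast)+
qed

theorem theorem4:
  fixes X :: "'a topology"
  assumes "compact_space X" and "Hausdorff_space X"
    and "Sln TYPE('k) X <o weight X"
  shows "\<exists>(Z :: (('a, 'k) ambient + nat) set \<Rightarrow> 'a set topology) \<pi>.
      inverse_spectrum (cardSuc (Sln TYPE('k) X)) Z \<pi> \<and>
      (\<forall>\<alpha> \<in> Field (cardSuc (Sln TYPE('k) X)).
         compact_space (Z \<alpha>) \<and> Hausdorff_space (Z \<alpha>) \<and> weight (Z \<alpha>) \<le>o Sln TYPE('k) X) \<and>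
      (\<forall>\<alpha> \<beta>. (\<alpha>, \<beta>) \<in> cardSuc (Sln TYPE('k) X) \<longrightarrow> monotone_map (Z \<beta>) (Z \<alpha>) (\<pi> \<alpha> \<beta>)) \<and>
      X homeomorphic_space inverse_limit (cardSuc (Sln TYPE('k) X)) Z \<pi>"
proof -
  have "completely_regular_space X"
    using assms(1,2) by (simp add: compact_Hausdorff_or_regular_imp_normal_space
        normal_imp_completely_regular_space)
  then obtain K :: "('a, 'k) ambient topology" where "continuum_containing X K"
    and \<kappa>: "Sln TYPE('k) X = continuum_Sln K"
    using Sln(1)[OF _ assms(2), where ?'k = 'k] by blast
  then obtain e where K: "continuum_space K" and e: "embedding_map X K e"
    unfolding continuum_containing_def by blast
  define r where "r = cardSuc (continuum_Sln K)"
  have r: "Card_order r" unfolding r_def by (rule cardSuc_Card_order[OF continuum_Sln(1)])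
  then have wo: "Well_order r" unfolding card_order_on_def by simp
  have short: "|underS r \<alpha>| \<le>o continuum_Sln K" if "\<alpha> \<in> Field r" for \<alpha>
    using card_of_underS[OF r that] cardSuc_ordLeq_ordLess[OF continuum_Sln(1)[of K] card_of_Card_order]
    unfolding r_def by blast
  have long: "\<not> |Field r| \<le>o continuum_Sln K"
  proof
    assume "|Field r| \<le>o continuum_Sln K"
    then have "r \<le>o continuum_Sln K"
      using card_of_Field_ordIso[OF r] ordIso_symmetric ordIso_ordLeq_trans by blast
    then show False
      using cardSuc_greater[OF continuum_Sln(1), of K] not_ordLess_ordLeq unfolding r_def by blast
  qed
  then have "r \<noteq> {}"
    using card_of_empty1[of "continuum_Sln K"] continuum_Sln(1)[of K] by auto
  let ?E = "e ` topspace X"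
  obtain g where g: "homeomorphic_maps X (subtopology K ?E) e g"
    using e unfolding embedding_map_def homeomorphic_map_maps by blast
  have econt: "continuous_map X K e"
    using g unfolding homeomorphic_maps_def continuous_map_in_subtopology by simp
  have eK: "e x \<in> topspace K" if "x \<in> topspace X" for x
    using continuous_map_image_subset_topspace[OF econt] that by blast
  have ge: "g (e x) = x" if "x \<in> topspace X" for x
    using g that unfolding homeomorphic_maps_def by simp
  have E: "closedin K ?E"
  proof (rule compactin_imp_closedin)
    show "Hausdorff_space K" using K unfolding continuum_space_def by simp
    show "compactin K ?E"
      using image_compactin[OF _ econt] assms(1) unfolding compact_space_def by blast
  qed
  obtain \<Phi> where
    weight: "\<forall>\<alpha>\<in>Field r. \<exists>\<W>. separating_opens K (fibre_component K (evaluation (\<Phi> \<alpha>))) \<W> \<and>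
      |\<W>| \<le>o continuum_Sln K"
    and mono: "\<forall>\<alpha> \<beta>. (\<alpha>, \<beta>) \<in> r \<longrightarrow> \<Phi> \<alpha> \<subseteq> \<Phi> \<beta>"
    and inE: "\<forall>\<alpha>\<in>Field r. \<forall>x\<in>?E. fibre_component K (evaluation (\<Phi> \<alpha>)) x \<subseteq> ?E"
    and sep: "\<forall>x\<in>topspace K. \<forall>y\<in>topspace K. x \<noteq> y \<longrightarrow>
      (\<exists>\<alpha>\<in>Field r. fibre_component K (evaluation (\<Phi> \<alpha>)) x \<noteq> fibre_component K (evaluation (\<Phi> \<alpha>)) y)"
    by (rule ex_tower_of_decompositions[OF K E wo short long])
  define c where "c \<alpha> = fibre_component K (evaluation (\<Phi> \<alpha>))" for \<alpha>
  (* The points of the spaces of the spectrum are the pieces of K inside the copy of X, pulled back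
     to X, so that they are subsets of X. *)
  define q where "q \<alpha> x = {y \<in> topspace X. e y \<in> c \<alpha> (e x)}" for \<alpha> x
  have q_eq_iff: "q \<alpha> x = q \<alpha> y \<longleftrightarrow> c \<alpha> (e x) = c \<alpha> (e y)"
    if "x \<in> topspace X" "y \<in> topspace X" for \<alpha> x y
  proof
    assume "q \<alpha> x = q \<alpha> y"
    moreover have "x \<in> q \<alpha> x"
      using that(1) fibre_component_refl[OF eK[OF that(1)]] unfolding q_def c_def by simp
    ultimately have "e x \<in> c \<alpha> (e y)" unfolding q_def by blast
    then show "c \<alpha> (e x) = c \<alpha> (e y)"
      unfolding c_def by (rule fibre_component_eq)
  qed (simp add: q_def)
  define Z where "Z \<alpha> = quotient_topology X (q \<alpha>)" for \<alpha>
  have opens: "\<exists>\<V>. separating_opens X (q \<alpha>) \<V> \<and> |\<V>| \<le>o continuum_Sln K" if \<alpha>: "\<alpha> \<in> Field r" for \<alpha>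
  proof -
    obtain \<W> where \<W>: "separating_opens K (c \<alpha>) \<W>" "|\<W>| \<le>o continuum_Sln K"
      using weight \<alpha> unfolding c_def by blast
    show ?thesis
      using separating_opens_preimage[OF econt \<W>(1) q_eq_iff] image_bound[OF \<W>(2)] by blast
  qed
  have Z: "compact_space (Z \<alpha>) \<and> Hausdorff_space (Z \<alpha>) \<and> weight (Z \<alpha>) \<le>o continuum_Sln K"
    if \<alpha>: "\<alpha> \<in> Field r" for \<alpha>
  proof -
    obtain \<V> where \<V>: "separating_opens X (q \<alpha>) \<V>" "|\<V>| \<le>o continuum_Sln K"
      using opens[OF \<alpha>] by blast
    show ?thesis
      unfolding Z_def
      by (intro conjI compact_space_quotient_topology[OF assms(1)]
          Hausdorff_space_quotient_topology[OF \<V>(1)]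
          weight_quotient_topology[OF assms(1) \<V> Cinfinite_continuum_Sln])
  qed
  have "\<exists>\<pi>. inverse_spectrum r Z \<pi> \<and>
      (\<forall>\<alpha> \<beta>. (\<alpha>, \<beta>) \<in> r \<longrightarrow> monotone_map (Z \<beta>) (Z \<alpha>) (\<pi> \<alpha> \<beta>)) \<and>
      X homeomorphic_space inverse_limit r Z \<pi>"
  proof (rule inverse_limit_of_quotients[OF assms(1) wo \<open>r \<noteq> {}\<close>])
    show "quotient_map X (Z \<alpha>) (q \<alpha>)" for \<alpha>
      unfolding Z_def by (rule quotient_map_quotient_topology)
    show "Hausdorff_space (Z \<alpha>)" if "\<alpha> \<in> Field r" for \<alpha>
      using Z[OF that] by simp
    show "connectedin X {x \<in> topspace X. q \<alpha> x = z}" if \<alpha>: "\<alpha> \<in> Field r" and "z \<in> topspace (Z \<alpha>)" for \<alpha> z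
    proof -
      obtain x where x: "x \<in> topspace X" "z = q \<alpha> x"
        using \<open>z \<in> topspace (Z \<alpha>)\<close> unfolding Z_def by auto
      have sub: "c \<alpha> (e x) \<subseteq> ?E"
        using inE \<alpha> x(1) unfolding c_def by blast
      (* The piece of K lies inside the copy of X, so the inverse homeomorphism carries all of it. *)
      have "{y \<in> topspace X. q \<alpha> y = z} = g ` c \<alpha> (e x)"
      proof (intro equalityI subsetI)
        fix y assume "y \<in> {y \<in> topspace X. q \<alpha> y = z}"
        then have y: "y \<in> topspace X" "c \<alpha> (e y) = c \<alpha> (e x)"
          using q_eq_iff[of y x \<alpha>] x by auto
        then have "e y \<in> c \<alpha> (e x)"
          using fibre_component_refl[OF eK[OF y(1)]] unfolding c_def by blast
        then show "y \<in> g ` c \<alpha> (e x)"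
          using ge[OF y(1)] by (metis image_eqI)
      next
        fix y assume "y \<in> g ` c \<alpha> (e x)"
        then obtain w where w: "w \<in> c \<alpha> (e x)" "y = g w" by blast
        then obtain y' where y': "y' \<in> topspace X" "w = e y'" using sub by blast
        then have "y = y'" using w ge by simp
        moreover have "c \<alpha> (e y') = c \<alpha> (e x)"
          using w(1) fibre_component_eq unfolding y'(2) c_def by fast
        ultimately show "y \<in> {y \<in> topspace X. q \<alpha> y = z}"
          using q_eq_iff[OF y'(1) x(1)] y' x by simp
      qed
      moreover have "connectedin (subtopology K ?E) (c \<alpha> (e x))"
        using sub unfolding c_def by (simp add: connectedin_subtopology connectedin_fibre_component)
      moreover have "continuous_map (subtopology K ?E) X g"
        using g unfolding homeomorphic_maps_def by simp
      ultimately show ?thesis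
        using connectedin_continuous_map_image by metis
    qed
    show "q \<alpha> x = q \<alpha> y" if "(\<alpha>, \<beta>) \<in> r" "x \<in> topspace X" "y \<in> topspace X" "q \<beta> x = q \<beta> y" for \<alpha> \<beta> x y
    proof -
      have "e y \<in> c \<beta> (e x)"
        using that q_eq_iff[OF that(2,3), of \<beta>] fibre_component_refl[OF eK[OF that(3)]] unfolding c_def by simp
      then have "e y \<in> c \<alpha> (e x)"
        using fibre_component_antimono[OF mono[rule_format, OF that(1)]] unfolding c_def by blast
      then have "c \<alpha> (e y) = c \<alpha> (e x)"
        unfolding c_def by (rule fibre_component_eq)
      then show ?thesis using q_eq_iff[OF that(2,3)] by simp
    qed
    show "\<exists>\<alpha>\<in>Field r. q \<alpha> x \<noteq> q \<alpha> y" if "x \<in> topspace X" "y \<in> topspace X" "x \<noteq> y" for x y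
    proof -
      have "e x \<noteq> e y" using ge that by metis
      then show ?thesis
        using sep eK[OF that(1)] eK[OF that(2)] q_eq_iff[OF that(1,2)] unfolding c_def by blast
    qed
  qed
  then show ?thesis
    unfolding \<kappa> r_def[symmetric] using Z by blast
qed

end
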